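(* Let $\Omega\subseteq\mathbb R^N$ be an open set with bounded inner radius $R:=\sup_{x\in\Omega}\operatorname{dist}(x,\partial\Omega)<\infty$. Let $K\in L^\infty(B_1)$ be a translation invariant kernel ($K(x,y)=K(y)$) with $\lambda\le K\le\Lambda$ on $B_1$, and assume $L_K$ is $1$-regular with constant $\Lambda$. Let $u\in L^\infty(B_1(\Omega))\cap C^{Dini}_{loc}(\Omega)$ with $\|L_Ku\|^{(1)}_{\mathcal L^1(\Omega)}<\infty$. Then there exists $\alpha=\alpha(\lambda,\Lambda,N)\in(0,1)$ such that $u\in\mathcal L^{1+\alpha}_{loc}(\Omega)$ and $$\|u\|^{(0)}_{\mathcal L^{1+\alpha}(\Omega)}\le C\big(\|u\|_{L^\infty(B_1(\Omega))}+\|L_Ku\|^{(1)}_{\mathcal L^1(\Omega)}\big)$$ for some $C=C(\lambda,\Lambda,N,R)>0$.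
   Context: $B_1(\Omega):=\bigcup_{x\in\Omega}B_1(x)$. $C^{Dini}_{loc}(\Omega)$: functions that on every closed ball in $\Omega$ admit a modulus of continuity $\omega$ with $\int_0^1\omega(\rho)\rho^{-1}d\rho<\infty$. $L_Ku(x):=\int_{B_1(x)}\frac{u(x)-u(y)}{|y-x|^N}K(y-x)\,dy$. $\ell(\rho):=|\ln(\min\{\rho,1/10\})|^{-1}$ ($\rho>0$), $\ell(0):=0$. $L_K$ is $\alpha$-regular with constant $\Lambda_0$ if, with $K$ extended by zero outside $B_1$, for all $z,w$ with $z\pm\frac w2\in\Omega$: $\int_{\mathbb R^N\setminus B_{2|w|}}\Big|\frac{K(\xi+\frac w2)}{|\xi+\frac w2|^N}-\frac{K(\xi-\frac w2)}{|\xi-\frac w2|^N}\Big|\ell(|\xi|)\,d\xi\le\Lambda_0\ell^\alpha(|w|)$. $d(x):=\operatorname{dist}(x,\partial\Omega)$, $d(x,y):=\min(d(x),d(y))$; $[u]_{\mathcal L^\alpha(U)}:=\sup_{x\ne y\in U}\frac{|u(x)-u(y)|}{\ell^\alpha(|x-y|)}$, $[u]^{(\beta)}_{\mathcal L^\alpha(\Omega)}:=\sup_{x\neq y\in\Omega}\ell^{\alpha+\beta}(d(x,y))\frac{|u(x)-u(y)|}{\ell^\alpha(|x-y|)}$, $\|u\|^{(\beta)}_{\mathcal L^\alpha(\Omega)}:=\sup_{x\in\Omega}\ell^\beta(d(x))|u(x)|+[u]^{(\beta)}_{\mathcal L^\alpha(\Omega)}$. $\mathcal L^\alpha_{loc}(\Omega)$: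 continuous $u$ with $\|u\|_{L^\infty(B)}+[u]_{\mathcal L^\alpha(B)}<\infty$ for every ball $B$ with $\overline B\subseteq\Omega$.
   Formalization: The ellipticity bound is taken with λ > 0, which the statement leaves implicit and without which it fails (K = 0, u Dini but not in any L^{1+α}_loc); Ω is taken nonempty and not the whole space, so that R is well defined. *)

theory Defs
  imports "HOL-Analysis.Analysis" "HOL-Probability.Essential_Supremum"
begin

definition ell :: "real \<Rightarrow> real" where
  "ell \<rho> = (if \<rho> > 0 then 1 / \<bar>ln (min \<rho> (1/10))\<bar> else 0)"

definition B1 :: "'a::euclidean_space set \<Rightarrow> 'a set" where
  "B1 \<Omega> = (\<Union>x\<in>\<Omega>. ball x 1)"

definition dB :: "'a::euclidean_space set \<Rightarrow> 'a \<Rightarrow> real" where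
  "dB \<Omega> x = infdist x (frontier \<Omega>)"

definition dB2 :: "'a::euclidean_space set \<Rightarrow> 'a \<Rightarrow> 'a \<Rightarrow> real" where
  "dB2 \<Omega> x y = min (dB \<Omega> x) (dB \<Omega> y)"

definition LK :: "('a::euclidean_space \<Rightarrow> real) \<Rightarrow> ('a \<Rightarrow> real) \<Rightarrow> 'a \<Rightarrow> real" where
  "LK K u x = set_lebesgue_integral lebesgue (ball x 1)
      (\<lambda>y. (u x - u y) / norm (y - x) ^ DIM('a) * K (y - x))"

definition Kext :: "('a::euclidean_space \<Rightarrow> real) \<Rightarrow> 'a \<Rightarrow> real" where
  "Kext K y = (if y \<in> ball 0 1 then K y else 0)"

definition regular :: "real \<Rightarrow> real \<Rightarrow> 'a::euclidean_space set \<Rightarrow> ('a \<Rightarrow> real) \<Rightarrow> bool" where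
  "regular \<alpha> \<Lambda>0 \<Omega> K \<longleftrightarrow>
     (\<forall>z w. z + w /\<^sub>R 2 \<in> \<Omega> \<longrightarrow> z - w /\<^sub>R 2 \<in> \<Omega> \<longrightarrow>
        set_nn_integral lebesgue (- ball 0 (2 * norm w))
          (\<lambda>\<xi>. ennreal (\<bar>Kext K (\<xi> + w /\<^sub>R 2) / norm (\<xi> + w /\<^sub>R 2) ^ DIM('a)
                        - Kext K (\<xi> - w /\<^sub>R 2) / norm (\<xi> - w /\<^sub>R 2) ^ DIM('a)\<bar>
                        * ell (norm \<xi>)))
        \<le> ennreal (\<Lambda>0 * ell (norm w) powr \<alpha>))"

definition modulus :: "(real \<Rightarrow> real) \<Rightarrow> bool" where
  "modulus \<omega> \<longleftrightarrow> \<omega> 0 = 0 \<and> (\<forall>r\<ge>0. \<omega> r \<ge> 0) \<and> mono_on {0..} \<omega>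
      \<and> (\<omega> \<longlongrightarrow> 0) (at_right 0)"

definition Dini_loc :: "'a::euclidean_space set \<Rightarrow> ('a \<Rightarrow> real) \<Rightarrow> bool" where
  "Dini_loc \<Omega> u \<longleftrightarrow>
     (\<forall>c r. cball c r \<subseteq> \<Omega> \<longrightarrow>
        (\<exists>\<omega>. modulus \<omega>
           \<and> (\<forall>x\<in>cball c r. \<forall>y\<in>cball c r. \<bar>u x - u y\<bar> \<le> \<omega> (dist x y))
           \<and> set_nn_integral lebesgue {0<..1} (\<lambda>\<rho>. ennreal (\<omega> \<rho> / \<rho>)) < \<infinity>))"

definition lsemi :: "real \<Rightarrow> 'a::euclidean_space set \<Rightarrow> ('a \<Rightarrow> real) \<Rightarrow> ennreal" where
  "lsemi \<alpha> U u = (SUP p\<in>{(x,y). x \<in> U \<and> y \<in> U \<and> x \<noteq> y}.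
      ennreal (\<bar>u (fst p) - u (snd p)\<bar> / ell (dist (fst p) (snd p)) powr \<alpha>))"

definition Lloc :: "real \<Rightarrow> 'a::euclidean_space set \<Rightarrow> ('a \<Rightarrow> real) \<Rightarrow> bool" where
  "Lloc \<alpha> \<Omega> u \<longleftrightarrow> continuous_on \<Omega> u \<and>
     (\<forall>c r. 0 < r \<longrightarrow> cball c r \<subseteq> \<Omega> \<longrightarrow>
        (SUP x\<in>ball c r. ennreal \<bar>u x\<bar>) + lsemi \<alpha> (ball c r) u < \<infinity>)"

definition wsemi :: "real \<Rightarrow> real \<Rightarrow> 'a::euclidean_space set \<Rightarrow> ('a \<Rightarrow> real) \<Rightarrow> ennreal" where
  "wsemi \<beta> \<alpha> \<Omega> u = (SUP p\<in>{(x,y). x \<in> \<Omega> \<and> y \<in> \<Omega> \<and> x \<noteq> y}.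
      ennreal (ell (dB2 \<Omega> (fst p) (snd p)) powr (\<alpha> + \<beta>) * \<bar>u (fst p) - u (snd p)\<bar>
               / ell (dist (fst p) (snd p)) powr \<alpha>))"

definition wnorm :: "real \<Rightarrow> real \<Rightarrow> 'a::euclidean_space set \<Rightarrow> ('a \<Rightarrow> real) \<Rightarrow> ennreal" where
  "wnorm \<beta> \<alpha> \<Omega> u = (SUP x\<in>\<Omega>. ennreal (ell (dB \<Omega> x) powr \<beta> * \<bar>u x\<bar>)) + wsemi \<beta> \<alpha> \<Omega> u"

definition Linf :: "'a::euclidean_space set \<Rightarrow> ('a \<Rightarrow> real) \<Rightarrow> ereal" where
  "Linf S u = esssup (lebesgue_on S) (\<lambda>x. ereal \<bar>u x\<bar>)"

end

theory Submission
  imports Defs "HOL-Probability.Probability_Measure"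
begin

text \<open>
  The exponent \<open>\<alpha> = 1/2\<close> works. Fix an increment \<open>w\<close> of length \<open>r\<close>, a point \<open>x0\<close> at distance \<open>d\<close> from the
  boundary, and put \<open>v x = u (x + w) - u x\<close>. As the kernel is translation invariant, \<open>L v\<close> is the increment of
  \<open>L u\<close>. Let \<open>xb\<close> maximise \<open>v\<close> minus a cone of height \<open>H \<ge> v\<close> and radius \<open>\<rho> = d / 4\<close>. In \<open>L v xb\<close> the part
  near \<open>xb\<close> has a nonnegative integrand, up to the slope of the cone, hence decreases if \<open>K\<close> is replaced there by a
  Lipschitz kernel of mass comparable to \<open>1 / ell r\<close>; integrated against that kernel, the translates of \<open>u\<close>
  cancel. This bounds \<open>v x0 / ell r\<close> by the increment of \<open>L u\<close>, \<open>H\<close>, and the far part of \<open>L v\<close>.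

  With \<open>H\<close> and the far part bounded through \<open>\<parallel>u\<parallel>\<close> alone, this gives \<open>\<bar>v x0\<bar> \<le> C * ell r / ell d\<close>. With this
  bound as the new \<open>H\<close>, and with the far part estimated by the regularity of the kernel, a second
  application gives \<open>\<bar>v x0\<bar> \<le> C * (ell r / ell d)\<^sup>2\<close>.
\<close>

section \<open>Radial integrals\<close>

definition sphere_area :: "nat \<Rightarrow> real" where
  "sphere_area n = real n * unit_ball_vol (real n)"

lemma sphere_area_nonneg: "0 \<le> sphere_area n"
  by (simp add: sphere_area_def)

lemma sphere_area_pos: "0 < n \<Longrightarrow> 0 < sphere_area n"
  by (simp add: sphere_area_def)

definition radial_density :: "nat \<Rightarrow> real \<Rightarrow> real" where
  "radial_density n t = (if 0 < t then sphere_area n * t ^ (n - 1) else 0)"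

lemma radial_density_nonneg: "0 \<le> radial_density n t"
  by (simp add: radial_density_def sphere_area_nonneg)

lemma borel_measurable_radial_density [measurable]: "radial_density n \<in> borel_measurable borel"
  unfolding radial_density_def[abs_def] by measurable

lemma nn_integral_radial_density_atMost:
  fixes a :: real
  assumes "0 < n"
  shows "(\<integral>\<^sup>+t. ennreal (radial_density n t * indicator {..a} t) \<partial>lborel) =
    ennreal (if 0 \<le> a then unit_ball_vol (real n) * a ^ n else 0)"
proof (cases "0 \<le> a")
  case True
  have "(\<integral>\<^sup>+t. ennreal (radial_density n t * indicator {..a} t) \<partial>lborel) =
    (\<integral>\<^sup>+t. ennreal (sphere_area n * t ^ (n - 1)) * indicator {0..a} t \<partial>lborel)"
    by (rule nn_integral_cong_AE, use AE_lborel_singleton[of "0::real"] in eventually_elim)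
      (auto simp: indicator_def radial_density_def)
  also have "\<dots> = ennreal (unit_ball_vol (real n) * a ^ n - unit_ball_vol (real n) * 0 ^ n)"
  proof (rule nn_integral_FTC_Icc)
    fix t :: real assume t: "t \<in> {0..a}"
    show "((\<lambda>t. unit_ball_vol (real n) * t ^ n) has_real_derivative sphere_area n * t ^ (n - 1)) (at t)"
      by (auto intro!: derivative_eq_intros simp: sphere_area_def)
    show "0 \<le> sphere_area n * t ^ (n - 1)" using t by (simp add: sphere_area_nonneg)
  qed (use True in auto)
  finally show ?thesis using True assms by (simp add: power_0_left)
next
  case False
  then have "(\<integral>\<^sup>+t. ennreal (radial_density n t * indicator {..a} t) \<partial>lborel) =
    (\<integral>\<^sup>+t. 0 \<partial>(lborel::real measure))"
    by (intro nn_integral_cong) (auto simp: indicator_def radial_density_def)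
  with False show ?thesis by simp
qed

lemma distributed_lborel_norm:
  "distributed (lborel :: 'a::euclidean_space measure) lborel norm
     (\<lambda>t. ennreal (radial_density DIM('a) t))"
proof (rule distributedI_borel_atMost)
  show "(\<integral>\<^sup>+t. ennreal (radial_density DIM('a) t * indicator {..a} t) \<partial>lborel) =
      ennreal (if 0 \<le> a then unit_ball_vol (real DIM('a)) * a ^ DIM('a) else 0)" for a :: real
    by (rule nn_integral_radial_density_atMost) simp
  fix a :: real
  have "{x \<in> space (lborel::'a measure). norm x \<le> a} = cball 0 a"
    by (auto simp: cball_def dist_norm)
  then show "emeasure (lborel::'a measure) {x \<in> space lborel. norm x \<le> a} =
      ennreal (if 0 \<le> a then unit_ball_vol (real DIM('a)) * a ^ DIM('a) else 0)"
    by (simp add: emeasure_cball)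
qed (auto intro!: AE_I2 simp: radial_density_nonneg)

lemma nn_integral_radial:
  fixes \<phi> :: "real \<Rightarrow> ennreal"
  assumes [measurable]: "\<phi> \<in> borel_measurable borel"
  shows "(\<integral>\<^sup>+z. \<phi> (norm z) \<partial>(lebesgue :: 'a::euclidean_space measure)) =
    ennreal (sphere_area DIM('a)) * (\<integral>\<^sup>+t\<in>{0<..}. \<phi> t * ennreal (t ^ (DIM('a) - 1)) \<partial>lborel)"
proof -
  have "(\<integral>\<^sup>+z. \<phi> (norm (z::'a)) \<partial>lebesgue) = (\<integral>\<^sup>+z. \<phi> (norm (z::'a)) \<partial>lborel)"
    by (rule nn_integral_completion)
  also have "\<dots> = (\<integral>\<^sup>+t. ennreal (radial_density DIM('a) t) * \<phi> t \<partial>lborel)"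
    by (rule distributed_nn_integral[OF distributed_lborel_norm, symmetric]) simp
  also have "\<dots> = (\<integral>\<^sup>+t. ennreal (sphere_area DIM('a)) *
      (\<phi> t * ennreal (t ^ (DIM('a) - 1)) * indicator {0<..} t) \<partial>lborel)"
    by (intro nn_integral_cong) (auto simp: indicator_def radial_density_def ennreal_mult' sphere_area_nonneg mult_ac)
  finally show ?thesis
    by (subst (asm) nn_integral_cmult) simp_all
qed

lemma nn_integral_radial_kernel:
  fixes \<phi> :: "real \<Rightarrow> real"
  assumes [measurable]: "\<phi> \<in> borel_measurable borel"
  shows "(\<integral>\<^sup>+z. ennreal (\<phi> (norm z) / norm z ^ DIM('a)) \<partial>(lebesgue :: 'a::euclidean_space measure)) =
    ennreal (sphere_area DIM('a)) * (\<integral>\<^sup>+t\<in>{0<..}. ennreal (\<phi> t / t) \<partial>lborel)"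
proof -
  have cancel_power: "ennreal (\<phi> t / t ^ DIM('a)) * ennreal (t ^ (DIM('a) - 1)) = ennreal (\<phi> t / t)"
    if "0 < t" for t
  proof -
    have "t ^ DIM('a) = t * t ^ (DIM('a) - 1)" by (rule power_eq_if[THEN trans]) simp
    then show ?thesis using that by (simp add: ennreal_mult''[symmetric])
  qed
  have "(\<integral>\<^sup>+t\<in>{0<..}. ennreal (\<phi> t / t ^ DIM('a)) * ennreal (t ^ (DIM('a) - 1)) \<partial>lborel) =
    (\<integral>\<^sup>+t\<in>{0<..}. ennreal (\<phi> t / t) \<partial>lborel)"
    using cancel_power by (intro nn_integral_cong) (simp add: indicator_def)
  then show ?thesis
    by (subst nn_integral_radial[where \<phi> = "\<lambda>t. ennreal (\<phi> t / t ^ DIM('a))"]) simp_all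
qed

lemma borel_measurable_lebesgueI:
  "f \<in> borel_measurable borel \<Longrightarrow> f \<in> borel_measurable lebesgue"
  by (intro measurable_completion) simp

lemma has_bochner_integral_radial_kernel:
  fixes \<phi> :: "real \<Rightarrow> real"
  assumes [measurable]: "\<phi> \<in> borel_measurable borel" and "\<And>t. 0 \<le> \<phi> t"
    and "(\<integral>\<^sup>+t\<in>{0<..}. ennreal (\<phi> t / t) \<partial>lborel) = ennreal c" "0 \<le> c"
  shows "has_bochner_integral (lebesgue :: 'a::euclidean_space measure)
    (\<lambda>z. \<phi> (norm z) / norm z ^ DIM('a)) (sphere_area DIM('a) * c)"
proof (rule has_bochner_integral_nn_integral)
  show "(\<lambda>z::'a. \<phi> (norm z) / norm z ^ DIM('a)) \<in> borel_measurable lebesgue"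
    by (rule borel_measurable_lebesgueI) measurable
qed (use assms in \<open>simp_all add: nn_integral_radial_kernel sphere_area_nonneg ennreal_mult\<close>)

lemma has_bochner_integral_annulus_kernel:
  fixes a b :: real
  assumes "0 < a" "a \<le> b"
  shows "has_bochner_integral (lebesgue :: 'a::euclidean_space measure)
    (\<lambda>z. indicator {a..<b} (norm z) / norm z ^ DIM('a)) (sphere_area DIM('a) * ln (b / a))"
proof (rule has_bochner_integral_radial_kernel)
  have "(\<integral>\<^sup>+t\<in>{0<..}. ennreal (indicator {a..<b} t / t) \<partial>lborel) = (\<integral>\<^sup>+t\<in>{a..b}. ennreal (1 / t) \<partial>lborel)"
    by (rule nn_integral_cong_AE, use AE_lborel_singleton[of b] in eventually_elim)
      (use assms in \<open>auto simp: indicator_def\<close>)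
  also have "\<dots> = ennreal (ln b - ln a)"
    using assms by (intro nn_integral_FTC_Icc) (auto intro!: derivative_eq_intros)
  finally show "(\<integral>\<^sup>+t\<in>{0<..}. ennreal (indicator {a..<b} t / t) \<partial>lborel) = ennreal (ln (b / a))"
    using assms by (simp add: ln_div)
qed (use assms in auto)

lemma
  fixes r \<rho> :: real
  assumes r: "0 \<le> r" "2 * r \<le> \<rho>" and \<rho>: "0 < \<rho>"
  defines "f \<equiv> \<lambda>z::'a::euclidean_space. indicator {\<rho> - r..<\<rho> + r} (norm z) / norm z ^ DIM('a)"
  shows integrable_shell_kernel: "integrable lebesgue f"
    and integral_shell_kernel_le: "integral\<^sup>L lebesgue f \<le> sphere_area DIM('a) * (4 * r / \<rho>)"
proof -
  have shell: "has_bochner_integral lebesgue f (sphere_area DIM('a) * ln ((\<rho> + r) / (\<rho> - r)))"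
    unfolding f_def using r \<rho> by (intro has_bochner_integral_annulus_kernel) auto
  then show "integrable lebesgue f" by (simp add: has_bochner_integral_iff)
  have "ln ((\<rho> + r) / (\<rho> - r)) \<le> (\<rho> + r) / (\<rho> - r) - 1"
    using r \<rho> by (intro ln_le_minus_one) auto
  also have "\<dots> = 2 * r / (\<rho> - r)" using r \<rho> by (simp add: field_simps)
  also have "\<dots> \<le> 2 * r / (\<rho> / 2)" using r \<rho> by (intro divide_left_mono) auto
  finally have "ln ((\<rho> + r) / (\<rho> - r)) \<le> 4 * r / \<rho>" by simp
  then show "integral\<^sup>L lebesgue f \<le> sphere_area DIM('a) * (4 * r / \<rho>)"
    using shell by (simp only: has_bochner_integral_iff mult_left_mono sphere_area_nonneg)
qed

lemma has_bochner_integral_cone_kernel: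
  fixes \<rho> :: real
  assumes "0 < \<rho>"
  shows "has_bochner_integral (lebesgue :: 'a::euclidean_space measure)
    (\<lambda>z. indicator {0..<\<rho>} (norm z) * (norm z / \<rho>) / norm z ^ DIM('a)) (sphere_area DIM('a))"
proof -
  have "(\<integral>\<^sup>+t\<in>{0<..}. ennreal (indicator {0..<\<rho>} t * (t / \<rho>) / t) \<partial>lborel) =
    (\<integral>\<^sup>+t\<in>{0..\<rho>}. ennreal (1 / \<rho>) \<partial>lborel)"
    by (rule nn_integral_cong_AE,
        use AE_lborel_singleton[of \<rho>] AE_lborel_singleton[of "0::real"] in eventually_elim)
      (use assms in \<open>auto simp: indicator_def\<close>)
  also have "\<dots> = ennreal 1"
    using assms by (simp add: nn_integral_cmult ennreal_mult''[symmetric])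
  finally have "has_bochner_integral (lebesgue :: 'a measure)
    (\<lambda>z. indicator {0..<\<rho>} (norm z) * (norm z / \<rho>) / norm z ^ DIM('a)) (sphere_area DIM('a) * 1)"
    by (intro has_bochner_integral_radial_kernel) (use assms in \<open>auto simp: indicator_def\<close>)
  then show ?thesis by simp
qed

lemma has_bochner_integral_indicator_ball:
  fixes c :: "'a::euclidean_space"
  assumes "0 \<le> \<rho>"
  shows "has_bochner_integral lebesgue (indicator (ball c \<rho>)) (unit_ball_vol (real DIM('a)) * \<rho> ^ DIM('a))"
  using has_bochner_integral_real_indicator[of "ball c \<rho>" lebesgue] emeasure_ball[OF assms, of c] content_ball[OF assms, of c]
  by simp

section \<open>Translations and increments\<close>

lemma
  fixes t :: "'a::euclidean_space"
  shows measurable_lebesgue_plus: "(+) t \<in> lebesgue \<rightarrow>\<^sub>M lebesgue"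
    and distr_lebesgue_plus: "distr lebesgue lebesgue ((+) t) = lebesgue"
  using lebesgue_affine_measurable[of "\<lambda>_. 1" t] lebesgue_affine_euclidean[of "\<lambda>_. 1" t]
  by (simp_all add: euclidean_representation density_1)

lemma borel_measurable_lebesgue_plus:
  fixes g :: "'a::euclidean_space \<Rightarrow> 'b::topological_space"
  shows "g \<in> borel_measurable lebesgue \<Longrightarrow> (\<lambda>z. g (t + z)) \<in> borel_measurable lebesgue"
  using measurable_compose[OF measurable_lebesgue_plus] .

lemma lebesgue_integral_plus:
  fixes g :: "'a::euclidean_space \<Rightarrow> real"
  assumes "g \<in> borel_measurable lebesgue"
  shows "(LINT z|lebesgue. g (t + z)) = (LINT z|lebesgue. g z)"
  using integral_distr[OF measurable_lebesgue_plus assms, of t] by (simp add: distr_lebesgue_plus)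

lemma lebesgue_integrable_plus:
  fixes g :: "'a::euclidean_space \<Rightarrow> real"
  shows "integrable lebesgue g \<Longrightarrow> integrable lebesgue (\<lambda>z. g (t + z))"
  using integrable_distr[OF measurable_lebesgue_plus, of t g] by (simp add: distr_lebesgue_plus)

lemma
  fixes g q :: "'a \<Rightarrow> real"
  assumes q: "integrable M q" and [measurable]: "g \<in> borel_measurable M" and g: "\<And>x. \<bar>g x\<bar> \<le> B"
  shows integrable_bounded_mult: "integrable M (\<lambda>x. g x * q x)"
    and abs_integral_bounded_mult_le: "\<bar>LINT x|M. g x * q x\<bar> \<le> B * (LINT x|M. \<bar>q x\<bar>)"
proof -
  have [measurable]: "q \<in> borel_measurable M" using q by (rule borel_measurable_integrable)
  have bound: "\<bar>g x * q x\<bar> \<le> B * \<bar>q x\<bar>" for x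
    unfolding abs_mult using g by (rule mult_right_mono) simp
  have dominant: "integrable M (\<lambda>x. B * \<bar>q x\<bar>)" using q by simp
  then show product: "integrable M (\<lambda>x. g x * q x)"
    by (rule Bochner_Integration.integrable_bound) (use bound in \<open>auto intro!: AE_I2 order_trans[OF bound]\<close>)
  have "\<bar>LINT x|M. g x * q x\<bar> \<le> (LINT x|M. \<bar>g x * q x\<bar>)" by (rule integral_abs_bound)
  also have "\<dots> \<le> (LINT x|M. B * \<bar>q x\<bar>)"
    using product dominant bound by (intro integral_mono) auto
  finally show "\<bar>LINT x|M. g x * q x\<bar> \<le> B * (LINT x|M. \<bar>q x\<bar>)" by simp
qed

definition increment :: "'a::ab_group_add \<Rightarrow> ('a \<Rightarrow> real) \<Rightarrow> 'a \<Rightarrow> real" where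
  "increment w u x = u (x + w) - u x"

lemma abs_increment_le:
  assumes "\<And>x. \<bar>u x\<bar> \<le> M"
  shows "\<bar>increment w u x\<bar> \<le> 2 * M"
  using assms[of x] assms[of "x + w"] unfolding increment_def by linarith

lemma borel_measurable_increment:
  fixes u :: "'a::euclidean_space \<Rightarrow> real"
  assumes "u \<in> borel_measurable lebesgue"
  shows "increment w u \<in> borel_measurable lebesgue"
  using assms borel_measurable_lebesgue_plus[OF assms, of w]
  unfolding increment_def[abs_def] by (intro borel_measurable_diff) (simp_all add: add.commute)

lemma abs_integral_increment_mult_le:
  fixes u q :: "'a::euclidean_space \<Rightarrow> real"
  assumes u: "u \<in> borel_measurable lebesgue" "\<And>x. \<bar>u x\<bar> \<le> M" and q: "integrable lebesgue q"
  shows "\<bar>LINT z|lebesgue. increment w u (x + z) * q z\<bar>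
    \<le> M * (LINT z|lebesgue. \<bar>q (z - w /\<^sub>R 2) - q (z + w /\<^sub>R 2)\<bar>)"
proof -
  define h where "h = w /\<^sub>R 2"
  have w: "w = h + h" by (simp add: h_def scaleR_2[symmetric])
  have u_mult: "integrable lebesgue (\<lambda>z. u (y + z) * p z)" if "integrable lebesgue p" for y p
    using that u by (intro integrable_bounded_mult borel_measurable_lebesgue_plus)
  have q_shift: "integrable lebesgue (\<lambda>z. q (z + y))" for y
    using lebesgue_integrable_plus[OF q, of y] by (simp add: add.commute)
  have translate: "(LINT z|lebesgue. u (y + z) * q z) = (LINT z|lebesgue. u (y + (t + z)) * q (t + z))" for t y
    using lebesgue_integral_plus[OF borel_measurable_integrable[OF u_mult[OF q]]] by (rule sym)
  have "increment w u (x + z) * q z = u (x + w + z) * q z - u (x + z) * q z" for z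
    by (simp add: increment_def algebra_simps)
  then have "(LINT z|lebesgue. increment w u (x + z) * q z)
     = (LINT z|lebesgue. u (x + w + z) * q z) - (LINT z|lebesgue. u (x + z) * q z)"
    by (simp add: u_mult[OF q])
  also have "\<dots> = (LINT z|lebesgue. u (x + h + z) * q (z - h)) - (LINT z|lebesgue. u (x + h + z) * q (z + h))"
    using translate[of "x + w" "- h"] translate[of x h] by (simp add: w algebra_simps)
  also have "\<dots> = (LINT z|lebesgue. u (x + h + z) * (q (z - h) - q (z + h)))"
    using u_mult[OF q_shift[of "- h"]] u_mult[OF q_shift[of h]] by (simp add: right_diff_distrib)
  finally show ?thesis
    using abs_integral_bounded_mult_le[of lebesgue "\<lambda>z. q (z - h) - q (z + h)" "\<lambda>z. u (x + h + z)" M]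
      q_shift[of "- h"] q_shift[of h] u borel_measurable_lebesgue_plus[OF u(1)]
    by (simp add: h_def)
qed

section \<open>A Lipschitz truncation of the kernel\<close>

lemma inverse_power_diff_le:
  fixes a s t :: real
  assumes "0 < a" "a \<le> s" "a \<le> t"
  shows "\<bar>1 / s ^ n - 1 / t ^ n\<bar> \<le> real n / a ^ Suc n * \<bar>s - t\<bar>"
proof -
  have "(a / s) ^ n - (a / t) ^ n = a ^ n * (1 / s ^ n - 1 / t ^ n)"
    by (simp add: power_divide right_diff_distrib)
  then have "\<bar>1 / s ^ n - 1 / t ^ n\<bar> = \<bar>(a / s) ^ n - (a / t) ^ n\<bar> / a ^ n"
    using assms by (simp add: abs_mult)
  also have "\<dots> \<le> real n * \<bar>a / s - a / t\<bar> / a ^ n"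
    using norm_power_diff[of "a / s" "a / t" n] assms by (intro divide_right_mono) auto
  also have "a / s - a / t = (a / s) * (1 / t) * (t - s)"
    using assms by (simp add: field_simps)
  also have "\<bar>\<dots>\<bar> = (a / s) * (1 / t) * \<bar>s - t\<bar>"
    using assms by (simp add: abs_mult abs_minus_commute)
  also have "\<dots> \<le> 1 * (1 / a) * \<bar>s - t\<bar>"
    using assms by (intro mult_right_mono mult_mono) (auto simp: frac_le)
  finally show ?thesis
    using assms by (simp add: divide_right_mono mult_left_mono)
qed

definition trunc_kernel :: "real \<Rightarrow> real \<Rightarrow> 'a::euclidean_space \<Rightarrow> real" where
  "trunc_kernel a \<rho> z = max 0 (1 / max (norm z) a ^ DIM('a) - 1 / \<rho> ^ DIM('a))"

lemma trunc_kernel_nonneg: "0 \<le> trunc_kernel a \<rho> z"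
  by (simp add: trunc_kernel_def)

lemma trunc_kernel_le:
  fixes z :: "'a::euclidean_space"
  assumes "0 < b" "b \<le> max (norm z) a" "0 < \<rho>"
  shows "trunc_kernel a \<rho> z \<le> 1 / b ^ DIM('a)"
proof -
  have "1 / max (norm z) a ^ DIM('a) \<le> 1 / b ^ DIM('a)"
    using assms by (intro divide_left_mono power_mono mult_pos_pos zero_less_power) auto
  moreover have "0 \<le> 1 / \<rho> ^ DIM('a)" using assms by simp
  ultimately have "1 / max (norm z) a ^ DIM('a) - 1 / \<rho> ^ DIM('a) \<le> 1 / b ^ DIM('a)" by linarith
  then show ?thesis unfolding trunc_kernel_def using assms by simp
qed

lemma trunc_kernel_eq_0:
  fixes z :: "'a::euclidean_space"
  assumes "0 < \<rho>" "\<rho> \<le> norm z"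
  shows "trunc_kernel a \<rho> z = 0"
proof -
  have "1 / max (norm z) a ^ DIM('a) \<le> 1 / \<rho> ^ DIM('a)"
    using assms by (intro divide_left_mono power_mono mult_pos_pos zero_less_power) auto
  then show ?thesis unfolding trunc_kernel_def by simp
qed

lemma trunc_kernel_lipschitz:
  fixes z z' :: "'a::euclidean_space"
  assumes "0 < a"
  shows "\<bar>trunc_kernel a \<rho> z - trunc_kernel a \<rho> z'\<bar> \<le> real DIM('a) / a ^ Suc DIM('a) * norm (z - z')"
proof -
  have "\<bar>trunc_kernel a \<rho> z - trunc_kernel a \<rho> z'\<bar> \<le>
      \<bar>1 / max (norm z) a ^ DIM('a) - 1 / max (norm z') a ^ DIM('a)\<bar>"
    unfolding trunc_kernel_def by linarith
  also have "\<dots> \<le> real DIM('a) / a ^ Suc DIM('a) * \<bar>max (norm z) a - max (norm z') a\<bar>"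
    using assms by (intro inverse_power_diff_le) auto
  also have "\<dots> \<le> real DIM('a) / a ^ Suc DIM('a) * norm (z - z')"
  proof (intro mult_left_mono)
    show "\<bar>max (norm z) a - max (norm z') a\<bar> \<le> norm (z - z')"
      using norm_triangle_ineq3[of z z'] by linarith
  qed (use assms in simp)
  finally show ?thesis .
qed

lemma integrable_trunc_kernel:
  assumes "0 < a" "0 < \<rho>"
  shows "integrable lebesgue (trunc_kernel a \<rho> :: 'a::euclidean_space \<Rightarrow> real)"
proof (rule Bochner_Integration.integrable_bound)
  show "integrable lebesgue (\<lambda>z::'a. 1 / a ^ DIM('a) * indicator (ball 0 \<rho>) z)"
    using has_bochner_integral_indicator_ball[of \<rho> "0::'a"] assms
    by (intro integrable_mult_right) (auto simp: has_bochner_integral_iff)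
  show "trunc_kernel a \<rho> \<in> borel_measurable (lebesgue :: 'a measure)"
    unfolding trunc_kernel_def[abs_def] by (rule borel_measurable_lebesgueI) measurable
  show "AE z in lebesgue. norm (trunc_kernel a \<rho> z) \<le> norm (1 / a ^ DIM('a) * indicator (ball 0 \<rho>) (z::'a))"
    using assms
    by (intro AE_I2) (auto simp: indicator_def trunc_kernel_nonneg trunc_kernel_eq_0 intro: trunc_kernel_le)
qed

lemma integral_trunc_kernel_ge:
  assumes "0 < a" "a < \<rho>"
  shows "sphere_area DIM('a) * (ln (\<rho> / a) - 1)
    \<le> (LINT z::'a::euclidean_space|lebesgue. trunc_kernel a \<rho> z)"
proof -
  have lower: "has_bochner_integral lebesgue
    (\<lambda>z::'a. indicator {a..<\<rho>} (norm z) / norm z ^ DIM('a) - 1 / \<rho> ^ DIM('a) * indicator (ball 0 \<rho>) z)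
    (sphere_area DIM('a) * ln (\<rho> / a) - 1 / \<rho> ^ DIM('a) * (unit_ball_vol (real DIM('a)) * \<rho> ^ DIM('a)))"
    using assms
    by (intro has_bochner_integral_diff has_bochner_integral_mult_right has_bochner_integral_annulus_kernel
        has_bochner_integral_indicator_ball) auto
  have "unit_ball_vol (real DIM('a)) \<le> sphere_area DIM('a)"
    unfolding sphere_area_def by (simp add: Suc_leI)
  then have "sphere_area DIM('a) * (ln (\<rho> / a) - 1) \<le>
    sphere_area DIM('a) * ln (\<rho> / a) - 1 / \<rho> ^ DIM('a) * (unit_ball_vol (real DIM('a)) * \<rho> ^ DIM('a))"
    using assms by (simp add: algebra_simps)
  also have "\<dots> = (LINT z::'a|lebesgue. indicator {a..<\<rho>} (norm z) / norm z ^ DIM('a)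
       - 1 / \<rho> ^ DIM('a) * indicator (ball 0 \<rho>) z)"
    using lower by (simp only: has_bochner_integral_iff)
  also have "\<dots> \<le> (LINT z::'a|lebesgue. trunc_kernel a \<rho> z)"
  proof (rule integral_mono)
    show "integrable lebesgue (\<lambda>z::'a. indicator {a..<\<rho>} (norm z) / norm z ^ DIM('a)
       - 1 / \<rho> ^ DIM('a) * indicator (ball 0 \<rho>) z)"
      using lower by (simp only: has_bochner_integral_iff)
    show "integrable lebesgue (trunc_kernel a \<rho> :: 'a \<Rightarrow> real)"
      using assms by (intro integrable_trunc_kernel) auto
    show "indicator {a..<\<rho>} (norm z) / norm z ^ DIM('a) - 1 / \<rho> ^ DIM('a) * indicator (ball 0 \<rho>) z
       \<le> trunc_kernel a \<rho> z" for z :: 'a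
      using assms by (auto simp: trunc_kernel_def indicator_def max_def)
  qed
  finally show ?thesis .
qed

lemma integral_trunc_kernel_diff_le:
  fixes w :: "'a::euclidean_space"
  assumes a: "0 < a" and \<rho>: "0 < \<rho>" "\<rho> + norm w \<le> 1"
  shows "(LINT z|lebesgue. \<bar>trunc_kernel a \<rho> (z - w /\<^sub>R 2) - trunc_kernel a \<rho> (z + w /\<^sub>R 2)\<bar>)
    \<le> sphere_area DIM('a) * norm w / a ^ Suc DIM('a)"
proof -
  let ?C = "real DIM('a) / a ^ Suc DIM('a) * norm w"
  let ?diff = "\<lambda>z::'a. trunc_kernel a \<rho> (z - w /\<^sub>R 2) - trunc_kernel a \<rho> (z + w /\<^sub>R 2)"
  have diff_le: "\<bar>?diff z\<bar> \<le> ?C * indicator (ball 0 1) z" for z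
  proof (cases "norm z < 1")
    case True
    have "norm ((z - w /\<^sub>R 2) - (z + w /\<^sub>R 2)) = norm w"
      by (simp add: algebra_simps scaleR_2[symmetric] flip: scaleR_add_left)
    then show ?thesis using True trunc_kernel_lipschitz[OF a, of \<rho> "z - w /\<^sub>R 2" "z + w /\<^sub>R 2"] by simp
  next
    case False
    have "norm (w /\<^sub>R 2) = norm w / 2" by simp
    then have "\<rho> \<le> norm (z - w /\<^sub>R 2)" "\<rho> \<le> norm (z + w /\<^sub>R 2)"
      using False \<rho>(2) norm_triangle_ineq2[of z "w /\<^sub>R 2"] norm_triangle_ineq2[of z "- (w /\<^sub>R 2)"]
        norm_ge_zero[of w] by (simp_all only: norm_minus_cancel diff_minus_eq_add)
    then show ?thesis using False by (simp add: trunc_kernel_eq_0[OF \<rho>(1)])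
  qed
  have ball: "has_bochner_integral lebesgue (\<lambda>z::'a. ?C * indicator (ball 0 1) z) (?C * unit_ball_vol (real DIM('a)))"
    using has_bochner_integral_indicator_ball[of 1 "0::'a"] by (intro has_bochner_integral_mult_right) simp
  have "(LINT z|lebesgue. \<bar>?diff z\<bar>) \<le> (LINT z::'a|lebesgue. ?C * indicator (ball 0 1) z)"
  proof (rule integral_mono)
    show "integrable lebesgue (\<lambda>z. \<bar>?diff z\<bar>)"
      using integrable_trunc_kernel[OF a \<rho>(1), THEN lebesgue_integrable_plus, of "- w /\<^sub>R 2"]
        integrable_trunc_kernel[OF a \<rho>(1), THEN lebesgue_integrable_plus, of "w /\<^sub>R 2"]
      by (simp add: add.commute)
  qed (use ball diff_le in \<open>simp_all only: has_bochner_integral_iff\<close>)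
  also have "\<dots> = sphere_area DIM('a) * norm w / a ^ Suc DIM('a)"
    using ball by (simp add: has_bochner_integral_iff sphere_area_def)
  finally show ?thesis .
qed

lemma abs_integral_increment_trunc_kernel_le:
  fixes u :: "'a::euclidean_space \<Rightarrow> real"
  assumes a: "0 < a" and \<rho>: "0 < \<rho>" "\<rho> + norm w \<le> 1"
    and u: "u \<in> borel_measurable lebesgue" "\<And>x. \<bar>u x\<bar> \<le> M"
  shows "\<bar>LINT z|lebesgue. increment w u (x + z) * trunc_kernel a \<rho> z\<bar>
    \<le> M * (sphere_area DIM('a) * norm w / a ^ Suc DIM('a))"
proof -
  have "\<bar>LINT z|lebesgue. increment w u (x + z) * trunc_kernel a \<rho> z\<bar>
      \<le> M * (LINT z|lebesgue. \<bar>trunc_kernel a \<rho> (z - w /\<^sub>R 2) - trunc_kernel a \<rho> (z + w /\<^sub>R 2)\<bar>)"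
    using a \<rho> u by (intro abs_integral_increment_mult_le integrable_trunc_kernel)
  also have "\<dots> \<le> M * (sphere_area DIM('a) * norm w / a ^ Suc DIM('a))"
    using u(2)[of 0] by (intro mult_left_mono integral_trunc_kernel_diff_le a \<rho>) auto
  finally show ?thesis .
qed

section \<open>The logarithmic modulus\<close>

lemma ell_pos: "0 < \<rho> \<Longrightarrow> 0 < ell \<rho>"
  by (simp add: ell_def min_def)

lemma ell_nonneg: "0 \<le> ell \<rho>"
  by (cases "0 < \<rho>") (simp add: ell_pos less_imp_le, simp add: ell_def)

lemma inverse_ell:
  assumes "0 < \<rho>"
  shows "1 / ell \<rho> = - ln (min \<rho> (1/10))"
proof -
  have "ln (min \<rho> (1/10)) < 0" using assms by (simp add: min_def)
  then show ?thesis using assms by (simp add: ell_def)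
qed

lemma exp_neg_inverse_ell: "0 < \<rho> \<Longrightarrow> exp (- (1 / ell \<rho>)) = min \<rho> (1/10)"
  by (simp only: inverse_ell) simp

lemma inverse_ell_antimono:
  assumes "0 < \<rho>" "\<rho> \<le> \<rho>'"
  shows "1 / ell \<rho>' \<le> 1 / ell \<rho>"
proof -
  have "ln (min \<rho> (1/10)) \<le> ln (min \<rho>' (1/10))"
    using assms by (subst ln_le_cancel_iff) (auto simp: min_def)
  then show ?thesis using assms by (simp only: inverse_ell)
qed

lemma ell_mono:
  assumes "\<rho> \<le> \<rho>'"
  shows "ell \<rho> \<le> ell \<rho>'"
proof (cases "0 < \<rho>")
  case True
  then show ?thesis
    using inverse_ell_antimono[OF True assms] ell_pos[of \<rho>] ell_pos[of \<rho>'] assms by (simp add: field_simps)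
next
  case False
  then show ?thesis using ell_nonneg[of \<rho>'] by (simp add: ell_def)
qed

lemma borel_measurable_ell [measurable]: "ell \<in> borel_measurable borel"
  by (intro borel_measurable_mono monoI ell_mono)

lemma ln_10_le_inverse_ell:
  assumes "0 < \<rho>"
  shows "ln 10 \<le> 1 / ell \<rho>"
proof -
  have "ln (min \<rho> (1/10)) \<le> ln (1/10)" using assms by (subst ln_le_cancel_iff) auto
  then show ?thesis using assms by (simp add: inverse_ell ln_div)
qed

lemma one_le_inverse_ell:
  assumes "0 < \<rho>"
  shows "1 \<le> 1 / ell \<rho>"
proof -
  have "1 \<le> ln (10::real)" using exp_le by (subst ln_ge_iff) auto
  then show ?thesis using ln_10_le_inverse_ell[OF assms] by linarith
qed

lemma
  assumes \<rho>: "0 < \<rho>" and c: "1/10 \<le> c" "c \<le> 1"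
  shows inverse_ell_mult_min: "1 / ell (c * min \<rho> (1/10)) = ln (1 / (c * min \<rho> (1/10)))"
    and inverse_ell_mult_min_le: "1 / ell (c * min \<rho> (1/10)) \<le> 2 * (1 / ell \<rho>)"
proof -
  let ?d = "min \<rho> (1/10)"
  have d: "0 < ?d" using \<rho> by simp
  have "c * ?d \<le> 1/10" using mult_mono[of c 1 ?d "1/10"] c \<rho> by simp
  then show log: "1 / ell (c * ?d) = ln (1 / (c * ?d))"
    using d c by (subst inverse_ell) (simp_all add: ln_div)
  have "ln (1 / c) \<le> ln 10" using c by (subst ln_le_cancel_iff) (auto simp: field_simps)
  then have "ln (1 / (c * ?d)) \<le> ln 10 + 1 / ell \<rho>"
    using c d \<rho> by (simp add: inverse_ell ln_div ln_mult)
  then show "1 / ell (c * ?d) \<le> 2 * (1 / ell \<rho>)"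
    unfolding log using ln_10_le_inverse_ell[OF \<rho>] by linarith
qed

section \<open>Kernels of logarithmic type\<close>

definition nonlocal_op :: "('a::euclidean_space \<Rightarrow> real) \<Rightarrow> ('a \<Rightarrow> real) \<Rightarrow> 'a \<Rightarrow> real" where
  "nonlocal_op k u x = (LINT z|lebesgue. (u x - u (x + z)) * k z)"

definition far_kernel :: "real \<Rightarrow> ('a::euclidean_space \<Rightarrow> real) \<Rightarrow> 'a \<Rightarrow> real" where
  "far_kernel \<rho> k z = (if norm z < \<rho> then 0 else k z)"

lemma integrable_Dini_modulus_kernel:
  assumes \<omega>: "modulus \<omega>" and Dini: "set_nn_integral lebesgue {0<..1} (\<lambda>t. ennreal (\<omega> t / t)) < \<infinity>"
    and \<epsilon>: "0 < \<epsilon>" "\<epsilon> \<le> 1"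
  shows "integrable lebesgue (\<lambda>z::'a::euclidean_space. indicator {0..<\<epsilon>} (norm z) * \<omega> (norm z) / norm z ^ DIM('a))"
proof -
  define \<phi> where "\<phi> t = indicator {0..<\<epsilon>} t * \<omega> (max 0 t)" for t
  have "mono (\<lambda>t. \<omega> (max 0 t))"
    using \<omega> by (auto simp: modulus_def mono_on_def intro!: monoI)
  then have [measurable]: "(\<lambda>t. \<omega> (max 0 t)) \<in> borel_measurable borel"
    by (rule borel_measurable_mono)
  have \<phi>: "\<phi> \<in> borel_measurable borel" "\<And>t. 0 \<le> \<phi> t"
    unfolding \<phi>_def using \<omega> by (measurable, simp add: modulus_def)
  have "(\<integral>\<^sup>+t\<in>{0<..}. ennreal (\<phi> t / t) \<partial>lborel) \<le> (\<integral>\<^sup>+t\<in>{0<..1}. ennreal (\<omega> t / t) \<partial>lborel)"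
    using \<epsilon> by (intro nn_integral_mono) (auto simp: \<phi>_def indicator_def)
  also have "\<dots> < \<infinity>" using Dini by (simp add: nn_integral_completion)
  finally obtain c where "0 \<le> c" "(\<integral>\<^sup>+t\<in>{0<..}. ennreal (\<phi> t / t) \<partial>lborel) = ennreal c"
    by (cases "\<integral>\<^sup>+t\<in>{0<..}. ennreal (\<phi> t / t) \<partial>lborel") auto
  with \<phi> have "has_bochner_integral lebesgue (\<lambda>z::'a. \<phi> (norm z) / norm z ^ DIM('a)) (sphere_area DIM('a) * c)"
    by (intro has_bochner_integral_radial_kernel)
  then show ?thesis by (auto simp: has_bochner_integral_iff \<phi>_def)
qed

text \<open>Since \<open>x / 0 = 0\<close>, at \<open>z = 0\<close> both bounds read \<open>k 0 = 0\<close>.\<close>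
locale log_kernel =
  fixes k :: "'a::euclidean_space \<Rightarrow> real" and lam Lam :: real
  assumes k_measurable [measurable]: "k \<in> borel_measurable lebesgue"
    and lam_pos: "0 < lam" and Lam_pos: "0 < Lam"
    and k_lower: "norm z < 1 \<Longrightarrow> lam / norm z ^ DIM('a) \<le> k z"
    and k_upper: "norm z < 1 \<Longrightarrow> k z \<le> Lam / norm z ^ DIM('a)"
    and k_eq_0: "1 \<le> norm z \<Longrightarrow> k z = 0"
begin

lemma k_nonneg: "0 \<le> k z"
proof (cases "norm z < 1")
  case True
  then show ?thesis using lam_pos by (intro order_trans[OF _ k_lower]) auto
qed (simp add: k_eq_0)

lemma k_le: "b \<le> norm z \<Longrightarrow> 0 < b \<Longrightarrow> k z \<le> Lam / b ^ DIM('a)"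
proof (cases "norm z < 1")
  case True
  assume b: "b \<le> norm z" "0 < b"
  have "k z \<le> Lam / norm z ^ DIM('a)" by (rule k_upper[OF True])
  also have "\<dots> \<le> Lam / b ^ DIM('a)"
    using b Lam_pos by (intro divide_left_mono power_mono mult_pos_pos zero_less_power) auto
  finally show ?thesis .
qed (use Lam_pos in \<open>simp add: k_eq_0\<close>)

lemma far_kernel_nonneg: "0 \<le> far_kernel \<rho> k z"
  by (simp add: far_kernel_def k_nonneg)

lemma far_kernel_le: "far_kernel \<rho> k z \<le> Lam * (indicator {\<rho>..<1} (norm z) / norm z ^ DIM('a))"
  using k_upper[of z] k_eq_0[of z] by (auto simp: far_kernel_def indicator_def not_less)

lemma far_kernel_measurable [measurable]: "far_kernel \<rho> k \<in> borel_measurable lebesgue"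
proof -
  have [measurable]: "Measurable.pred lebesgue (\<lambda>z::'a. norm z < \<rho>)"
    by (rule measurable_completion) simp
  show ?thesis unfolding far_kernel_def[abs_def] by measurable
qed

lemma
  assumes "0 < \<rho>" "\<rho> \<le> 1"
  shows integrable_far_kernel: "integrable lebesgue (far_kernel \<rho> k)"
    and integral_far_kernel_le: "(LINT z|lebesgue. far_kernel \<rho> k z) \<le> Lam * (sphere_area DIM('a) * ln (1 / \<rho>))"
proof -
  have annulus: "has_bochner_integral lebesgue
      (\<lambda>z::'a. Lam * (indicator {\<rho>..<1} (norm z) / norm z ^ DIM('a))) (Lam * (sphere_area DIM('a) * ln (1 / \<rho>)))"
    using assms by (intro has_bochner_integral_mult_right has_bochner_integral_annulus_kernel)
  then have annulus_integrable: "integrable lebesgue (\<lambda>z::'a. Lam * (indicator {\<rho>..<1} (norm z) / norm z ^ DIM('a)))"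
    by (simp only: has_bochner_integral_iff)
  then show far: "integrable lebesgue (far_kernel \<rho> k)"
    by (rule Bochner_Integration.integrable_bound)
      (use far_kernel_le far_kernel_nonneg in \<open>auto intro!: AE_I2 order_trans[OF far_kernel_le] simp del: times_divide_eq_right\<close>)
  have "(LINT z|lebesgue. far_kernel \<rho> k z)
      \<le> (LINT z::'a|lebesgue. Lam * (indicator {\<rho>..<1} (norm z) / norm z ^ DIM('a)))"
    using far annulus_integrable far_kernel_le by (rule integral_mono)
  then show "(LINT z|lebesgue. far_kernel \<rho> k z) \<le> Lam * (sphere_area DIM('a) * ln (1 / \<rho>))"
    using annulus by (simp only: has_bochner_integral_iff)
qed

lemma abs_integral_far_kernel_le:
  assumes \<rho>: "0 < \<rho>" "\<rho> \<le> 1" and g: "g \<in> borel_measurable lebesgue" "\<And>z. \<bar>g z\<bar> \<le> B"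
  shows "\<bar>LINT z|lebesgue. g z * far_kernel \<rho> k z\<bar> \<le> B * (Lam * (sphere_area DIM('a) * ln (1 / \<rho>)))"
proof -
  have "\<bar>LINT z|lebesgue. g z * far_kernel \<rho> k z\<bar> \<le> B * (LINT z|lebesgue. \<bar>far_kernel \<rho> k z\<bar>)"
    using integrable_far_kernel[OF \<rho>] g by (rule abs_integral_bounded_mult_le)
  also have "\<dots> \<le> B * (Lam * (sphere_area DIM('a) * ln (1 / \<rho>)))"
    using integral_far_kernel_le[OF \<rho>] g(2)[of 0] by (intro mult_left_mono) (simp_all add: far_kernel_nonneg)
  finally show ?thesis .
qed

lemma integrable_nonlocal_integrand_of_modulus:
  assumes u: "u \<in> borel_measurable lebesgue" "\<And>x. \<bar>u x\<bar> \<le> M"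
    and \<omega>: "modulus \<omega>" "set_nn_integral lebesgue {0<..1} (\<lambda>t. ennreal (\<omega> t / t)) < \<infinity>"
    and \<epsilon>: "0 < \<epsilon>" "\<epsilon> \<le> 1"
    and u_\<omega>: "\<And>z. norm z < \<epsilon> \<Longrightarrow> \<bar>u x - u (x + z)\<bar> \<le> \<omega> (norm z)"
  shows "integrable lebesgue (\<lambda>z. (u x - u (x + z)) * k z)"
proof -
  define majorant where "majorant z = Lam * (indicator {0..<\<epsilon>} (norm z) * \<omega> (norm z) / norm z ^ DIM('a))
    + 2 * M * far_kernel \<epsilon> k z" for z
  have "integrable lebesgue majorant"
    unfolding majorant_def using integrable_Dini_modulus_kernel[OF \<omega> \<epsilon>] integrable_far_kernel[OF \<epsilon>]
    by (intro Bochner_Integration.integrable_add integrable_mult_right)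
  then show ?thesis
  proof (rule Bochner_Integration.integrable_bound)
    show "(\<lambda>z. (u x - u (x + z)) * k z) \<in> borel_measurable lebesgue"
      using borel_measurable_lebesgue_plus[OF u(1)] by measurable
    have "\<bar>u x - u (x + z)\<bar> * k z \<le> majorant z" for z
    proof (cases "norm z < \<epsilon>")
      case True
      then have "\<bar>u x - u (x + z)\<bar> * k z \<le> \<omega> (norm z) * (Lam / norm z ^ DIM('a))"
        using u_\<omega>[OF True] k_upper[of z] k_nonneg[of z] \<epsilon> by (intro mult_mono) auto
      then show ?thesis using True by (simp add: majorant_def far_kernel_def mult_ac)
    next
      case False
      have "\<bar>u x - u (x + z)\<bar> \<le> 2 * M" using u(2)[of x] u(2)[of "x + z"] by linarith
      then have "\<bar>u x - u (x + z)\<bar> * k z \<le> 2 * M * k z" using k_nonneg by (rule mult_right_mono)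
      then show ?thesis using False by (simp add: majorant_def far_kernel_def)
    qed
    then show "AE z in lebesgue. norm ((u x - u (x + z)) * k z) \<le> norm (majorant z)"
      by (intro AE_I2) (auto simp: abs_mult k_nonneg intro: order_trans[OF _ abs_ge_self])
  qed
qed

lemma integrable_nonlocal_integrand:
  assumes u: "u \<in> borel_measurable lebesgue" "\<And>x. \<bar>u x\<bar> \<le> M"
    and "open \<Omega>" "Dini_loc \<Omega> u" "x \<in> \<Omega>"
  shows "integrable lebesgue (\<lambda>z. (u x - u (x + z)) * k z)"
proof -
  obtain r where r: "0 < r" "cball x r \<subseteq> \<Omega>" using assms open_contains_cball by blast
  define \<epsilon> where "\<epsilon> = min r 1"
  have \<epsilon>: "0 < \<epsilon>" "\<epsilon> \<le> 1" and "cball x \<epsilon> \<subseteq> \<Omega>" using r by (auto simp: \<epsilon>_def)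
  then obtain \<omega> where \<omega>: "modulus \<omega>" "set_nn_integral lebesgue {0<..1} (\<lambda>\<rho>. ennreal (\<omega> \<rho> / \<rho>)) < \<infinity>"
    and u_\<omega>: "\<And>y z. y \<in> cball x \<epsilon> \<Longrightarrow> z \<in> cball x \<epsilon> \<Longrightarrow> \<bar>u y - u z\<bar> \<le> \<omega> (dist y z)"
    using assms(4) unfolding Dini_loc_def by blast
  have "\<bar>u x - u (x + z)\<bar> \<le> \<omega> (norm z)" if "norm z < \<epsilon>" for z
    using u_\<omega>[of x "x + z"] that \<epsilon> by (simp add: dist_norm)
  with u \<omega> \<epsilon> show ?thesis by (rule integrable_nonlocal_integrand_of_modulus)
qed

end

section \<open>The maximum principle\<close>

definition radial_cone :: "real \<Rightarrow> real \<Rightarrow> 'a::real_normed_vector \<Rightarrow> 'a \<Rightarrow> real" where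
  "radial_cone H \<rho> x0 x = H * min 1 (dist x x0 / \<rho>)"

lemma radial_cone_centre: "radial_cone H \<rho> x0 x0 = 0"
  by (simp add: radial_cone_def)

lemma radial_cone_nonneg: "0 \<le> H \<Longrightarrow> 0 < \<rho> \<Longrightarrow> 0 \<le> radial_cone H \<rho> x0 x"
  by (simp add: radial_cone_def)

lemma radial_cone_outside: "0 < \<rho> \<Longrightarrow> x \<notin> ball x0 \<rho> \<Longrightarrow> radial_cone H \<rho> x0 x = H"
  by (simp add: radial_cone_def min_def dist_commute)

lemma radial_cone_add_le:
  assumes "0 \<le> H" "0 < \<rho>"
  shows "radial_cone H \<rho> x0 (x + z) \<le> radial_cone H \<rho> x0 x + H * (norm z / \<rho>)"
proof -
  have "dist (x + z) x0 \<le> dist x x0 + norm z"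
    using dist_triangle[of "x + z" x0 x] by (simp add: dist_norm)
  then have "dist (x + z) x0 / \<rho> \<le> dist x x0 / \<rho> + norm z / \<rho>"
    using assms by (simp add: divide_right_mono add_divide_distrib[symmetric])
  moreover have "0 \<le> norm z / \<rho>" using assms by simp
  ultimately have "min 1 (dist (x + z) x0 / \<rho>) \<le> min 1 (dist x x0 / \<rho>) + norm z / \<rho>" by linarith
  then show ?thesis
    using assms unfolding radial_cone_def distrib_left[symmetric] by (intro mult_left_mono)
qed

lemma exists_cone_maximum:
  fixes v :: "'a::euclidean_space \<Rightarrow> real"
  assumes \<rho>: "0 < \<rho>" and v_cont: "continuous_on (cball x0 \<rho>) v"
    and v_le: "\<And>x. x \<in> ball x0 (2 * \<rho>) \<Longrightarrow> v x \<le> H" and v_pos: "0 < v x0"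
  obtains xb where "xb \<in> ball x0 \<rho>" "v x0 \<le> v xb"
    "\<And>z. norm z < \<rho> \<Longrightarrow> v (xb + z) \<le> v xb + H * (norm z / \<rho>)"
proof -
  let ?\<psi> = "radial_cone H \<rho> x0"
  have H_nonneg: "0 \<le> H" using v_le[of x0] v_pos \<rho> by simp
  have "continuous_on (cball x0 \<rho>) (\<lambda>x. v x - ?\<psi> x)"
    unfolding radial_cone_def by (rule continuous_on_diff[OF v_cont]) (intro continuous_intros, use \<rho> in auto)
  then obtain xb where xb: "xb \<in> cball x0 \<rho>" and max: "\<And>x. x \<in> cball x0 \<rho> \<Longrightarrow> v x - ?\<psi> x \<le> v xb - ?\<psi> xb"
    using continuous_attains_sup[of "cball x0 \<rho>" "\<lambda>x. v x - ?\<psi> x"] \<rho> by auto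
  have max_ge: "v x0 \<le> v xb - ?\<psi> xb" using max[of x0] \<rho> by (simp add: radial_cone_centre)
  have xb_ball: "xb \<in> ball x0 \<rho>"
  proof (rule ccontr)
    assume "xb \<notin> ball x0 \<rho>"
    then have "?\<psi> xb = H" by (rule radial_cone_outside[OF \<rho>])
    moreover have "v xb \<le> H" using xb \<rho> by (intro v_le) auto
    ultimately show False using max_ge v_pos by simp
  qed
  have max_double_ball: "v x - ?\<psi> x \<le> v xb - ?\<psi> xb" if "x \<in> ball x0 (2 * \<rho>)" for x
  proof (cases "x \<in> ball x0 \<rho>")
    case False
    then have "?\<psi> x = H" by (rule radial_cone_outside[OF \<rho>])
    then show ?thesis using v_le[OF that] max_ge v_pos by simp
  qed (auto intro: max)
  show thesis
  proof (rule that[OF xb_ball])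
    show "v x0 \<le> v xb" using max_ge radial_cone_nonneg[OF H_nonneg \<rho>, of x0 xb] by simp
    fix z :: 'a assume "norm z < \<rho>"
    then have "xb + z \<in> ball x0 (2 * \<rho>)"
      using xb_ball dist_triangle[of x0 "xb + z" xb] by (simp add: dist_norm)
    then show "v (xb + z) \<le> v xb + H * (norm z / \<rho>)"
      using max_double_ball[of "xb + z"] radial_cone_add_le[OF H_nonneg \<rho>, of x0 xb z] by simp
  qed
qed

context log_kernel
begin

text \<open>Inside the ball the integrand is nonnegative after adding the cone, so the kernel may be replaced by a
  smaller one there; the truncated kernel is Lipschitz, so increments nearly cancel against it.\<close>
lemma trunc_kernel_comparison:
  assumes a: "0 < a" and \<rho>: "0 < \<rho>" "\<rho> \<le> 1" and z: "z \<noteq> 0" and H: "0 \<le> H" and p: "0 \<le> p"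
    and cone: "norm z < \<rho> \<Longrightarrow> q \<le> p + H * (norm z / \<rho>)"
  shows "lam * (p * trunc_kernel a \<rho> z - q * trunc_kernel a \<rho> z)
      - Lam * H * (indicator {0..<\<rho>} (norm z) * (norm z / \<rho>) / norm z ^ DIM('a)) - q * far_kernel \<rho> k z
    \<le> (p - q) * k z"
proof (cases "norm z < \<rho>")
  case True
  then have z1: "norm z < 1" using \<rho> by simp
  define slope where "slope = H * (norm z / \<rho>)"
  have slope: "0 \<le> slope" "0 \<le> p - q + slope" using H \<rho> cone[OF True] by (simp_all add: slope_def)
  have "lam * trunc_kernel a \<rho> z * (p - q) \<le> lam * trunc_kernel a \<rho> z * (p - q + slope)"
    using slope lam_pos trunc_kernel_nonneg[of a \<rho> z] by (intro mult_left_mono) auto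
  also have "\<dots> \<le> k z * (p - q + slope)"
  proof (rule mult_right_mono)
    have "lam * trunc_kernel a \<rho> z \<le> lam * (1 / norm z ^ DIM('a))"
      using lam_pos z \<rho> by (intro mult_left_mono trunc_kernel_le) auto
    then show "lam * trunc_kernel a \<rho> z \<le> k z" using k_lower[OF z1] by simp
  qed (rule slope)
  also have "\<dots> \<le> (p - q) * k z + slope * (Lam / norm z ^ DIM('a))"
    using mult_left_mono[OF k_upper[OF z1] slope(1)] by (simp add: algebra_simps)
  finally show ?thesis using True by (simp add: slope_def far_kernel_def algebra_simps)
next
  case False
  then show ?thesis
    using trunc_kernel_eq_0[OF \<rho>(1), of z a] p k_nonneg[of z] by (simp add: far_kernel_def left_diff_distrib)
qed

lemma nonlocal_op_ge_at_cone_maximum: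
  assumes v: "v \<in> borel_measurable lebesgue" "\<And>x. \<bar>v x\<bar> \<le> B"
    and a: "0 < a" and \<rho>: "0 < \<rho>" "\<rho> \<le> 1" and H: "0 \<le> H"
    and v_integrable: "integrable lebesgue (\<lambda>z. (v x - v (x + z)) * k z)"
    and cone_maximum: "0 \<le> v x" "\<And>z. norm z < \<rho> \<Longrightarrow> v (x + z) \<le> v x + H * (norm z / \<rho>)"
  shows "lam * (v x * (LINT z::'a|lebesgue. trunc_kernel a \<rho> z) - (LINT z|lebesgue. v (x + z) * trunc_kernel a \<rho> z))
      - Lam * H * sphere_area DIM('a) - (LINT z|lebesgue. v (x + z) * far_kernel \<rho> k z) \<le> nonlocal_op k v x"
proof -
  define minorant where "minorant z = lam * (v x * trunc_kernel a \<rho> z - v (x + z) * trunc_kernel a \<rho> z)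
    - Lam * H * (indicator {0..<\<rho>} (norm z) * (norm z / \<rho>) / norm z ^ DIM('a))
    - v (x + z) * far_kernel \<rho> k z" for z
  have v_mult: "integrable lebesgue (\<lambda>z. v (x + z) * p z)" if "integrable lebesgue p" for p
    using that v by (intro integrable_bounded_mult borel_measurable_lebesgue_plus)
  have minorant: "has_bochner_integral lebesgue minorant
    (lam * (v x * (LINT z::'a|lebesgue. trunc_kernel a \<rho> z) - (LINT z|lebesgue. v (x + z) * trunc_kernel a \<rho> z))
      - Lam * H * sphere_area DIM('a) - (LINT z|lebesgue. v (x + z) * far_kernel \<rho> k z))"
    unfolding minorant_def using a \<rho>
    by (intro has_bochner_integral_diff has_bochner_integral_mult_right has_bochner_integral_integrable
        has_bochner_integral_cone_kernel integrable_trunc_kernel v_mult integrable_far_kernel)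
  have "integral\<^sup>L lebesgue minorant \<le> nonlocal_op k v x"
    unfolding nonlocal_op_def
  proof (rule integral_mono[OF _ v_integrable])
    show "minorant z \<le> (v x - v (x + z)) * k z" for z
    proof (cases "z = 0")
      case False
      then show ?thesis
        unfolding minorant_def using a \<rho> H cone_maximum by (intro trunc_kernel_comparison)
    qed (simp add: minorant_def far_kernel_def \<rho>)
  qed (use minorant in \<open>simp only: has_bochner_integral_iff\<close>)
  then show ?thesis using minorant by (simp only: has_bochner_integral_iff)
qed

lemma cone_max_principle:
  assumes v: "v \<in> borel_measurable lebesgue" "\<And>x. \<bar>v x\<bar> \<le> B"
    and a: "0 < a" "a < \<rho>" and \<rho>: "\<rho> \<le> 1"
    and v_cont: "continuous_on (cball x0 \<rho>) v"
    and v_integrable: "\<And>x. x \<in> ball x0 \<rho> \<Longrightarrow> integrable lebesgue (\<lambda>z. (v x - v (x + z)) * k z)"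
    and op_le: "\<And>x. x \<in> ball x0 \<rho> \<Longrightarrow> nonlocal_op k v x \<le> E"
    and v_le: "\<And>x. x \<in> ball x0 (2 * \<rho>) \<Longrightarrow> v x \<le> H"
    and trunc_le: "\<And>x. x \<in> ball x0 \<rho> \<Longrightarrow> (LINT z|lebesgue. v (x + z) * trunc_kernel a \<rho> z) \<le> T"
    and far_le: "\<And>x. x \<in> ball x0 \<rho> \<Longrightarrow> (LINT z|lebesgue. v (x + z) * far_kernel \<rho> k z) \<le> S"
    and v_pos: "0 < v x0"
  shows "lam * (sphere_area DIM('a) * (ln (\<rho> / a) - 1) * v x0) \<le> E + lam * T + Lam * H * sphere_area DIM('a) + S"
proof -
  let ?mass = "LINT z::'a|lebesgue. trunc_kernel a \<rho> z"
  have \<rho>_pos: "0 < \<rho>" using a by simp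
  obtain xb where xb: "xb \<in> ball x0 \<rho>" "v x0 \<le> v xb"
    and cone: "\<And>z. norm z < \<rho> \<Longrightarrow> v (xb + z) \<le> v xb + H * (norm z / \<rho>)"
    using exists_cone_maximum[OF \<rho>_pos v_cont v_le v_pos] by blast
  have "0 \<le> H" using v_le[of x0] v_pos \<rho>_pos by simp
  then have "lam * (v xb * ?mass - (LINT z|lebesgue. v (xb + z) * trunc_kernel a \<rho> z))
      - Lam * H * sphere_area DIM('a) - (LINT z|lebesgue. v (xb + z) * far_kernel \<rho> k z) \<le> nonlocal_op k v xb"
    using xb v_pos by (intro nonlocal_op_ge_at_cone_maximum[OF v a(1) \<rho>_pos \<rho>] v_integrable cone) auto
  then have "lam * (v xb * ?mass) \<le> E + lam * T + Lam * H * sphere_area DIM('a) + S"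
    using op_le[OF xb(1)] mult_left_mono[OF trunc_le[OF xb(1)] less_imp_le[OF lam_pos]] far_le[OF xb(1)]
    by (simp add: right_diff_distrib)
  moreover have "sphere_area DIM('a) * (ln (\<rho> / a) - 1) * v x0 \<le> v xb * ?mass"
  proof -
    have "sphere_area DIM('a) * (ln (\<rho> / a) - 1) * v x0 \<le> ?mass * v x0"
      using integral_trunc_kernel_ge[OF a, where 'a='a] v_pos by (intro mult_right_mono) auto
    also have "\<dots> \<le> ?mass * v xb"
      using xb by (intro mult_left_mono integral_nonneg) (auto simp: trunc_kernel_nonneg)
    finally show ?thesis by (simp add: mult.commute)
  qed
  then have "lam * (sphere_area DIM('a) * (ln (\<rho> / a) - 1) * v x0) \<le> lam * (v xb * ?mass)"
    using lam_pos by (intro mult_left_mono) auto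
  ultimately show ?thesis by linarith
qed

end

section \<open>The far part of a regular kernel\<close>

definition increment_regular :: "('a::euclidean_space \<Rightarrow> real) \<Rightarrow> real \<Rightarrow> 'a \<Rightarrow> bool" where
  "increment_regular k c w \<longleftrightarrow>
     (\<integral>\<^sup>+\<xi>\<in>- ball 0 (2 * norm w). ennreal (\<bar>k (\<xi> + w /\<^sub>R 2) - k (\<xi> - w /\<^sub>R 2)\<bar> * ell (norm \<xi>)) \<partial>lebesgue)
       \<le> ennreal (c * ell (norm w))"

lemma
  fixes k :: "'a::euclidean_space \<Rightarrow> real"
  assumes k: "k \<in> borel_measurable lebesgue" and "0 \<le> c" and reg: "increment_regular k c w"
  defines "f \<equiv> \<lambda>\<xi>. \<bar>k (\<xi> + w /\<^sub>R 2) - k (\<xi> - w /\<^sub>R 2)\<bar> * ell (norm \<xi>) * indicator (- ball 0 (2 * norm w)) \<xi>"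
  shows increment_regular_integrable: "integrable lebesgue f"
    and increment_regular_integral_le: "integral\<^sup>L lebesgue f \<le> c * ell (norm w)"
proof -
  have [measurable]: "(\<lambda>z. k (z + y)) \<in> borel_measurable lebesgue" for y
    using borel_measurable_lebesgue_plus[OF k, of y] by (simp add: add.commute)
  have [measurable]: "(\<lambda>z. k (z - y)) \<in> borel_measurable lebesgue" for y
    using borel_measurable_lebesgue_plus[OF k, of "- y"] by simp
  have [measurable]: "(\<lambda>z::'a. ell (norm z) * indicator (- ball 0 (2 * norm w)) z) \<in> borel_measurable lebesgue"
    by (rule borel_measurable_lebesgueI) measurable
  have f_meas: "f \<in> borel_measurable lebesgue"
    unfolding f_def mult.assoc by measurable
  have f_le: "(\<integral>\<^sup>+\<xi>. ennreal (f \<xi>) \<partial>lebesgue) \<le> ennreal (c * ell (norm w))"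
    using reg unfolding increment_regular_def f_def
    by (rule order_trans[rotated]) (auto intro!: nn_integral_mono simp: indicator_def)
  then show "integral\<^sup>L lebesgue f \<le> c * ell (norm w)"
    using \<open>0 \<le> c\<close> by (intro integral_real_bounded) (auto simp: ell_nonneg)
  show "integrable lebesgue f"
    using f_meas
  proof (rule integrableI_nonneg)
    show "AE \<xi> in lebesgue. 0 \<le> f \<xi>" by (simp add: f_def ell_nonneg)
    show "(\<integral>\<^sup>+\<xi>. ennreal (f \<xi>) \<partial>lebesgue) < \<infinity>" using f_le by (rule le_less_trans) simp
  qed
qed

context log_kernel
begin

lemma far_kernel_diff_le_shell:
  assumes z: "0 < norm z" "norm z \<le> 2 * \<rho>"
  shows "\<bar>far_kernel \<rho> k x - far_kernel \<rho> k y\<bar> \<le> Lam * 2 ^ DIM('a) * (1 / norm z ^ DIM('a))"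
proof -
  have \<rho>: "0 < \<rho>" using z by linarith
  have far_le: "far_kernel \<rho> k x \<le> Lam / \<rho> ^ DIM('a)" for x
    using \<rho> Lam_pos k_le[of \<rho> x] by (simp add: far_kernel_def)
  have "\<bar>far_kernel \<rho> k x - far_kernel \<rho> k y\<bar> \<le> Lam / \<rho> ^ DIM('a)"
    using far_le[of x] far_le[of y] far_kernel_nonneg[of \<rho> x] far_kernel_nonneg[of \<rho> y] by linarith
  also have "\<dots> = Lam * 2 ^ DIM('a) / (2 * \<rho>) ^ DIM('a)" by (simp add: power_mult_distrib)
  also have "\<dots> \<le> Lam * 2 ^ DIM('a) / norm z ^ DIM('a)"
    using z \<rho> Lam_pos by (intro divide_left_mono power_mono mult_pos_pos zero_less_power) auto
  finally show ?thesis by simp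
qed

lemma far_kernel_diff_le:
  assumes h: "8 * norm h \<le> \<rho>" and \<rho>: "0 < \<rho>"
  shows "\<bar>far_kernel \<rho> k (z - h) - far_kernel \<rho> k (z + h)\<bar> \<le>
    1 / ell (\<rho> / 2) * (\<bar>k (z + h) - k (z - h)\<bar> * ell (norm z) * indicator (- ball 0 (4 * norm h)) z)
    + Lam * 2 ^ DIM('a) * (indicator {\<rho> - norm h..<\<rho> + norm h} (norm z) / norm z ^ DIM('a))"
    (is "?D \<le> ?regular + ?shell")
proof -
  have ell_half: "0 < ell (\<rho> / 2)" using \<rho> by (intro ell_pos) simp
  have nonneg: "0 \<le> ?regular" "0 \<le> ?shell" using ell_half Lam_pos by (simp_all add: ell_nonneg)
  have near_z: "\<bar>norm (z - h) - norm z\<bar> \<le> norm h" "\<bar>norm (z + h) - norm z\<bar> \<le> norm h"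
    using norm_triangle_ineq3[of "z - h" z] norm_triangle_ineq3[of "z + h" z] by auto
  consider (outside) "\<rho> \<le> norm (z - h)" "\<rho> \<le> norm (z + h)"
    | (inside) "norm (z - h) < \<rho>" "norm (z + h) < \<rho>"
    | (shell) "\<rho> - norm h \<le> norm z" "norm z < \<rho> + norm h"
    using near_z by linarith
  then show ?thesis
  proof cases
    case outside
    then have z: "\<rho> / 2 \<le> norm z" "4 * norm h \<le> norm z" using near_z h \<rho> by linarith+
    have "?D * ell (\<rho> / 2) \<le> \<bar>k (z + h) - k (z - h)\<bar> * ell (norm z)"
      using outside z(1) ell_half
      by (intro mult_mono ell_mono) (auto simp: far_kernel_def abs_minus_commute)
    then have "?D \<le> ?regular" using ell_half z(2) by (simp add: field_simps)
    then show ?thesis using nonneg by linarith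
  next
    case inside
    then have "?D = 0" by (simp add: far_kernel_def)
    then show ?thesis using nonneg by linarith
  next
    case shell
    then have "0 < norm z" "norm z \<le> 2 * \<rho>" using h \<rho> by linarith+
    then have "?D \<le> Lam * 2 ^ DIM('a) * (1 / norm z ^ DIM('a))" by (rule far_kernel_diff_le_shell)
    also have "\<dots> = ?shell" using shell by simp
    finally show ?thesis using nonneg by linarith
  qed
qed

lemma integral_far_kernel_diff_le:
  assumes w: "w \<noteq> 0" "4 * norm w \<le> \<rho>" "\<rho> \<le> 1" and reg: "increment_regular k Lam w"
  shows "(LINT z|lebesgue. \<bar>far_kernel \<rho> k (z - w /\<^sub>R 2) - far_kernel \<rho> k (z + w /\<^sub>R 2)\<bar>)
    \<le> Lam * (ell (norm w) / ell (\<rho> / 2) + 2 ^ DIM('a) * sphere_area DIM('a) * (2 * norm w / \<rho>))"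
proof -
  have \<rho>: "0 < \<rho>" using w zero_less_norm_iff[of w] by linarith
  have ell_half: "0 < ell (\<rho> / 2)" using \<rho> by (intro ell_pos) simp
  define regular_part where "regular_part z = \<bar>k (z + w /\<^sub>R 2) - k (z - w /\<^sub>R 2)\<bar> * ell (norm z) * indicator (- ball 0 (2 * norm w)) z" for z
  define shell where "shell z = indicator {\<rho> - norm w / 2..<\<rho> + norm w / 2} (norm z) / norm z ^ DIM('a)" for z :: 'a
  have regular_part: "integrable lebesgue regular_part" "integral\<^sup>L lebesgue regular_part \<le> Lam * ell (norm w)"
    using increment_regular_integrable[OF k_measurable _ reg] increment_regular_integral_le[OF k_measurable _ reg]
      Lam_pos unfolding regular_part_def[abs_def] by simp_all
  have shell: "integrable lebesgue shell" "integral\<^sup>L lebesgue shell \<le> sphere_area DIM('a) * (4 * (norm w / 2) / \<rho>)"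
    unfolding shell_def[abs_def] using w \<rho> by (intro integrable_shell_kernel integral_shell_kernel_le; simp)+
  have "(LINT z|lebesgue. \<bar>far_kernel \<rho> k (z - w /\<^sub>R 2) - far_kernel \<rho> k (z + w /\<^sub>R 2)\<bar>)
      \<le> (LINT z|lebesgue. 1 / ell (\<rho> / 2) * regular_part z + Lam * 2 ^ DIM('a) * shell z)"
  proof (rule integral_mono)
    show "integrable lebesgue (\<lambda>z. \<bar>far_kernel \<rho> k (z - w /\<^sub>R 2) - far_kernel \<rho> k (z + w /\<^sub>R 2)\<bar>)"
      using lebesgue_integrable_plus[OF integrable_far_kernel[OF \<rho> w(3)], of "- w /\<^sub>R 2"]
        lebesgue_integrable_plus[OF integrable_far_kernel[OF \<rho> w(3)], of "w /\<^sub>R 2"]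
      by (simp add: add.commute)
    show "integrable lebesgue (\<lambda>z. 1 / ell (\<rho> / 2) * regular_part z + Lam * 2 ^ DIM('a) * shell z)"
      using regular_part shell by (intro Bochner_Integration.integrable_add integrable_mult_right)
    show "\<bar>far_kernel \<rho> k (z - w /\<^sub>R 2) - far_kernel \<rho> k (z + w /\<^sub>R 2)\<bar>
        \<le> 1 / ell (\<rho> / 2) * regular_part z + Lam * 2 ^ DIM('a) * shell z" for z
      using far_kernel_diff_le[of "w /\<^sub>R 2" \<rho> z] w \<rho> by (simp add: regular_part_def shell_def)
  qed
  also have "\<dots> = 1 / ell (\<rho> / 2) * integral\<^sup>L lebesgue regular_part + Lam * 2 ^ DIM('a) * integral\<^sup>L lebesgue shell"
    using regular_part shell by simp
  also have "\<dots> \<le> 1 / ell (\<rho> / 2) * (Lam * ell (norm w))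
      + Lam * 2 ^ DIM('a) * (sphere_area DIM('a) * (4 * (norm w / 2) / \<rho>))"
    using regular_part shell ell_half Lam_pos by (intro add_mono mult_left_mono) auto
  also have "\<dots> = Lam * (ell (norm w) / ell (\<rho> / 2) + 2 ^ DIM('a) * sphere_area DIM('a) * (2 * norm w / \<rho>))"
    by (simp add: algebra_simps)
  finally show ?thesis .
qed

lemma abs_integral_increment_far_kernel_le:
  assumes u: "u \<in> borel_measurable lebesgue" "\<And>x. \<bar>u x\<bar> \<le> M"
    and w: "w \<noteq> 0" "4 * norm w \<le> \<rho>" "\<rho> \<le> 1" and reg: "increment_regular k Lam w"
  shows "\<bar>LINT z|lebesgue. increment w u (x + z) * far_kernel \<rho> k z\<bar>
    \<le> M * (Lam * (ell (norm w) / ell (\<rho> / 2) + 2 ^ DIM('a) * sphere_area DIM('a) * (2 * norm w / \<rho>)))"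
proof -
  have "0 < \<rho>" using w zero_less_norm_iff[of w] by linarith
  then have "\<bar>LINT z|lebesgue. increment w u (x + z) * far_kernel \<rho> k z\<bar>
      \<le> M * (LINT z|lebesgue. \<bar>far_kernel \<rho> k (z - w /\<^sub>R 2) - far_kernel \<rho> k (z + w /\<^sub>R 2)\<bar>)"
    using u w by (intro abs_integral_increment_mult_le integrable_far_kernel)
  also have "\<dots> \<le> M * (Lam * (ell (norm w) / ell (\<rho> / 2) + 2 ^ DIM('a) * sphere_area DIM('a) * (2 * norm w / \<rho>)))"
    using integral_far_kernel_diff_le[OF w reg] u(2)[of 0] by (intro mult_left_mono) auto
  finally show ?thesis .
qed

end

section \<open>Distance to the boundary\<close>

lemma ball_dB_subset:
  fixes \<Omega> :: "'a::euclidean_space set"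
  assumes "x \<in> \<Omega>"
  shows "ball x (dB \<Omega> x) \<subseteq> \<Omega>"
proof (rule ccontr)
  assume not_subset: "\<not> ball x (dB \<Omega> x) \<subseteq> \<Omega>"
  then have "ball x (dB \<Omega> x) \<noteq> {}" by blast
  then have "0 < dB \<Omega> x" by (simp add: not_le)
  then have "ball x (dB \<Omega> x) \<inter> \<Omega> \<noteq> {}" using assms centre_in_ball by blast
  with not_subset have "ball x (dB \<Omega> x) \<inter> frontier \<Omega> \<noteq> {}"
    by (intro connected_Int_frontier) auto
  then obtain y where "y \<in> frontier \<Omega>" "dist x y < dB \<Omega> x" by auto
  then show False using infdist_le[of y "frontier \<Omega>" x] by (simp add: dB_def)
qed

lemma dB2_commute: "dB2 \<Omega> x y = dB2 \<Omega> y x"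
  by (simp add: dB2_def min.commute)

lemma dB2_translate_ge: "dB2 \<Omega> x (x + w) - dist x y \<le> dB2 \<Omega> y (y + w)"
  using infdist_triangle[of x "frontier \<Omega>" y] infdist_triangle[of "x + w" "frontier \<Omega>" "y + w"]
  by (auto simp: dB2_def dB_def min_def)

locale proper_open =
  fixes \<Omega> :: "'a::euclidean_space set"
  assumes open_\<Omega>: "open \<Omega>" and nonempty: "\<Omega> \<noteq> {}" and proper: "\<Omega> \<noteq> UNIV"
begin

lemma dB_pos:
  assumes "x \<in> \<Omega>"
  shows "0 < dB \<Omega> x"
  unfolding dB_def
proof (rule infdist_pos_not_in_closed)
  show "frontier \<Omega> \<noteq> {}" using nonempty proper by (simp add: frontier_eq_empty)
  show "x \<notin> frontier \<Omega>" using assms open_\<Omega> by (simp add: frontier_def interior_open)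
qed simp

lemma dB2_pos: "x \<in> \<Omega> \<Longrightarrow> y \<in> \<Omega> \<Longrightarrow> 0 < dB2 \<Omega> x y"
  by (simp add: dB2_def dB_pos)

end

lemma Dini_loc_continuous:
  assumes "open \<Omega>" "Dini_loc \<Omega> u"
  shows "continuous_on \<Omega> u"
proof (rule continuous_at_imp_continuous_on, rule ballI)
  fix x assume "x \<in> \<Omega>"
  then obtain r where r: "0 < r" "cball x r \<subseteq> \<Omega>" using assms(1) open_contains_cball by blast
  then obtain \<omega> where \<omega>: "modulus \<omega>" and u_\<omega>: "\<And>y z. y \<in> cball x r \<Longrightarrow> z \<in> cball x r \<Longrightarrow> \<bar>u y - u z\<bar> \<le> \<omega> (dist y z)"
    using assms(2) unfolding Dini_loc_def by blast
  show "isCont u x"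
    unfolding continuous_at_eps_delta
  proof (intro allI impI)
    fix e :: real assume "0 < e"
    then have "\<forall>\<^sub>F t in at_right 0. \<omega> t < e"
      using \<omega> unfolding modulus_def by (auto dest: order_tendstoD(2))
    then obtain b where b: "0 < b" "\<And>t. 0 < t \<Longrightarrow> t < b \<Longrightarrow> \<omega> t < e"
      unfolding eventually_at_right_field by blast
    have "dist (u y) (u x) < e" if "dist y x < min b r" for y
    proof (cases "y = x")
      case False
      then have "\<omega> (dist y x) < e" using that by (intro b) auto
      moreover have "\<bar>u y - u x\<bar> \<le> \<omega> (dist y x)" using that r by (intro u_\<omega>) (auto simp: dist_commute)
      ultimately show ?thesis by (simp add: dist_real_def)
    qed (use \<open>0 < e\<close> in simp)
    then show "\<exists>d>0. \<forall>y. dist y x < d \<longrightarrow> dist (u y) (u x) < e"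
      using b r by (intro exI[of _ "min b r"]) auto
  qed
qed

section \<open>Increments at the scale of the distance to the boundary\<close>

locale log_kernel_equation = log_kernel k lam Lam + proper_open \<Omega>
  for k :: "'a::euclidean_space \<Rightarrow> real" and lam Lam :: real and \<Omega> :: "'a set" +
  fixes u :: "'a \<Rightarrow> real" and M F :: real
  assumes u_measurable: "u \<in> borel_measurable lebesgue" and abs_u_le: "\<And>x. \<bar>u x\<bar> \<le> M"
    and u_Dini: "Dini_loc \<Omega> u"
    and F_nonneg: "0 \<le> F"
    and nonlocal_op_diff_le: "\<And>x y. x \<in> \<Omega> \<Longrightarrow> y \<in> \<Omega> \<Longrightarrow> x \<noteq> y \<Longrightarrow>
        \<bar>nonlocal_op k u x - nonlocal_op k u y\<bar> \<le> F * ell (dist x y) / (ell (dB2 \<Omega> x y))\<^sup>2"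
    and k_regular: "\<And>x w. x \<in> \<Omega> \<Longrightarrow> x + w \<in> \<Omega> \<Longrightarrow> increment_regular k Lam w"
begin

lemma M_nonneg: "0 \<le> M"
  using abs_u_le[of 0] by linarith

lemma M_add_F_nonneg: "0 \<le> M + F"
  using M_nonneg F_nonneg by simp

lemma abs_increment_u_le: "\<bar>increment w u x\<bar> \<le> 2 * M"
  by (intro abs_increment_le abs_u_le)

lemma u_continuous: "continuous_on \<Omega> u"
  using open_\<Omega> u_Dini by (rule Dini_loc_continuous)

lemma
  assumes "x \<in> \<Omega>" "x + w \<in> \<Omega>"
  shows integrable_nonlocal_increment:
      "integrable lebesgue (\<lambda>z. (increment w u x - increment w u (x + z)) * k z)"
    and nonlocal_op_increment:
      "nonlocal_op k (increment w u) x = nonlocal_op k u (x + w) - nonlocal_op k u x"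
proof -
  have int: "integrable lebesgue (\<lambda>z. (u y - u (y + z)) * k z)" if "y \<in> \<Omega>" for y
    using u_measurable abs_u_le open_\<Omega> u_Dini that by (rule integrable_nonlocal_integrand)
  have split: "(increment w u x - increment w u (x + z)) * k z =
      (u (x + w) - u (x + w + z)) * k z - (u x - u (x + z)) * k z" for z
    by (simp add: increment_def algebra_simps)
  show "integrable lebesgue (\<lambda>z. (increment w u x - increment w u (x + z)) * k z)"
    unfolding split using int assms by (intro Bochner_Integration.integrable_diff)
  show "nonlocal_op k (increment w u) x = nonlocal_op k u (x + w) - nonlocal_op k u x"
    unfolding nonlocal_op_def split using int assms by (intro Bochner_Integration.integral_diff)
qed

end

definition decay_const :: "nat \<Rightarrow> real \<Rightarrow> real" where
  "decay_const n lam = 4 * (real n + 1) / (lam * sphere_area n)"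

definition first_order_const :: "nat \<Rightarrow> real \<Rightarrow> real \<Rightarrow> real" where
  "first_order_const n lam Lam =
    decay_const n lam * (4 + 2 * lam * sphere_area n + 6 * Lam * sphere_area n) + 2 * (12 * (real n + 1))"

definition second_order_const :: "nat \<Rightarrow> real \<Rightarrow> real \<Rightarrow> real" where
  "second_order_const n lam Lam =
    decay_const n lam * (4 + 2 * lam * sphere_area n + 2 * first_order_const n lam Lam * Lam * sphere_area n
      + Lam * (2 + 16 * 2 ^ n * sphere_area n)) + 2 * (12 * (real n + 1))\<^sup>2"

context log_kernel
begin

lemma decay_const_nonneg: "0 \<le> decay_const DIM('a) lam"
  using lam_pos by (simp add: decay_const_def sphere_area_nonneg)

lemma first_order_const_pos: "0 < first_order_const DIM('a) lam Lam"
  unfolding first_order_const_def using lam_pos Lam_pos decay_const_nonneg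
  by (intro add_nonneg_pos mult_nonneg_nonneg add_nonneg_nonneg) (auto simp: sphere_area_nonneg)

lemma second_order_const_pos: "0 < second_order_const DIM('a) lam Lam"
  unfolding second_order_const_def using lam_pos Lam_pos decay_const_nonneg first_order_const_pos
  by (intro add_nonneg_pos mult_nonneg_nonneg add_nonneg_nonneg) (auto simp: sphere_area_nonneg)

end

text \<open>The increment has length \<open>exp (- log_step)\<close> and the distance to the boundary, capped at \<open>1/10\<close>, is
  \<open>exp (- log_depth)\<close>. The cutoff is the power of the length for which the error \<open>norm w / cutoff ^ (N + 1)\<close>
  still decays, while \<open>ln (depth / cutoff)\<close> is comparable to \<open>log_step\<close>.\<close>
locale small_increment = log_kernel_equation k lam Lam \<Omega> u M F
  for k :: "'a::euclidean_space \<Rightarrow> real" and lam Lam :: real and \<Omega> :: "'a set"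
    and u :: "'a \<Rightarrow> real" and M F :: real +
  fixes x0 w :: 'a
  assumes x0_mem: "x0 \<in> \<Omega>" "x0 + w \<in> \<Omega>" and w_nonzero: "w \<noteq> 0"
    and small: "12 * (real DIM('a) + 1) * (1 / ell (dB2 \<Omega> x0 (x0 + w))) \<le> 1 / ell (norm w)"
begin

definition log_step :: real where
  "log_step = 1 / ell (norm w)"

definition log_depth :: real where
  "log_depth = 1 / ell (dB2 \<Omega> x0 (x0 + w))"

definition depth :: real where
  "depth = min (dB2 \<Omega> x0 (x0 + w)) (1/10)"

definition cutoff :: real where
  "cutoff = exp (- (log_step / (2 * (real DIM('a) + 1))))"

lemma depth_pos: "0 < depth" and depth_le: "depth \<le> 1/10"
  using x0_mem by (simp_all add: depth_def dB2_pos)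

lemma depth_eq: "depth = exp (- log_depth)"
  using x0_mem by (simp only: depth_def log_depth_def exp_neg_inverse_ell dB2_pos)

lemma log_depth_ge_ln_10: "ln 10 \<le> log_depth" and log_depth_ge_1: "1 \<le> log_depth"
  using x0_mem by (simp_all only: log_depth_def ln_10_le_inverse_ell one_le_inverse_ell dB2_pos)

lemma log_step_ge: "12 * (real DIM('a) + 1) * log_depth \<le> log_step"
  using small by (simp only: log_step_def log_depth_def)

lemma log_step_ge_24: "24 * log_depth \<le> log_step"
proof -
  have "24 * log_depth \<le> 12 * (real DIM('a) + 1) * log_depth"
    using log_depth_ge_1 by (intro mult_right_mono) (auto simp: Suc_leI)
  then show ?thesis using log_step_ge by linarith
qed

lemma log_step_pos: "0 < log_step"
  using log_step_ge_24 log_depth_ge_1 by linarith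

lemma exp_neg_half_log_step_le: "exp (- (log_step / 2)) \<le> 2 / log_step"
proof -
  have "log_step / 2 \<le> exp (log_step / 2)" using exp_ge_add_one_self[of "log_step / 2"] by linarith
  then show ?thesis using log_step_pos by (simp add: exp_minus field_simps)
qed

lemma norm_w_eq: "norm w = exp (- log_step)"
proof -
  have "exp (- log_step) < exp (- ln 10)"
    using log_step_ge_24 log_depth_ge_ln_10 log_depth_ge_1 by (subst exp_less_cancel_iff) linarith
  then have "exp (- log_step) < 1/10" by (simp add: exp_minus)
  moreover have "exp (- log_step) = min (norm w) (1/10)"
    unfolding log_step_def using w_nonzero by (intro exp_neg_inverse_ell) simp
  ultimately show ?thesis by (simp add: min_def split: if_splits)
qed

lemma norm_w_div_depth_le: "norm w / depth \<le> 2 / log_step"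
proof -
  have "norm w / depth = exp (- log_step + log_depth)"
    by (simp add: norm_w_eq depth_eq exp_diff[symmetric])
  also have "\<dots> \<le> exp (- (log_step / 2))" using log_step_ge_24 log_depth_ge_1 by simp
  finally show ?thesis using exp_neg_half_log_step_le by linarith
qed

lemma norm_w_le_depth: "100 * norm w \<le> depth"
proof -
  have "norm w \<le> exp (3 * - log_depth)"
    unfolding norm_w_eq using log_step_ge_24 log_depth_ge_1 by simp
  also have "\<dots> = depth * depth\<^sup>2"
    unfolding depth_eq using exp_of_nat_mult[of 3 "- log_depth"] by (simp add: power2_eq_square power3_eq_cube)
  also have "\<dots> \<le> depth * (1/10)\<^sup>2"
    using depth_pos depth_le by (intro mult_left_mono power_mono) auto
  finally show ?thesis by (simp add: power2_eq_square)
qed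

lemma cutoff_pos: "0 < cutoff"
  by (simp add: cutoff_def)

lemma norm_w_div_cutoff_power_le: "norm w / cutoff ^ Suc DIM('a) \<le> 2 / log_step"
proof -
  have "cutoff ^ Suc DIM('a) = exp (real (Suc DIM('a)) * - (log_step / (2 * (real DIM('a) + 1))))"
    unfolding cutoff_def by (rule exp_of_nat_mult[symmetric])
  also have "real (Suc DIM('a)) * - (log_step / (2 * (real DIM('a) + 1))) = - (log_step / 2)"
    by (simp add: field_simps)
  finally have "norm w / cutoff ^ Suc DIM('a) = exp (- (log_step / 2))"
    by (simp only: norm_w_eq exp_diff[symmetric]) simp
  then show ?thesis using exp_neg_half_log_step_le by simp
qed

lemma ln_depth_div_cutoff_ge: "log_step / (4 * (real DIM('a) + 1)) \<le> ln (depth / 4 / cutoff) - 1"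
proof -
  have "ln 4 \<le> log_depth" using log_depth_ge_ln_10 by (rule order_trans[rotated]) simp
  moreover have "3 * log_depth \<le> log_step / (4 * (real DIM('a) + 1))"
    using log_step_ge by (simp add: field_simps)
  moreover have "ln (depth / 4 / cutoff) = 2 * (log_step / (4 * (real DIM('a) + 1))) - log_depth - ln 4"
    by (simp add: cutoff_def depth_eq ln_div ln_mult) (simp add: field_simps)
  ultimately show ?thesis using log_depth_ge_1 by linarith
qed

lemma cutoff_less: "cutoff < depth / 4"
proof -
  have "0 < log_step / (4 * (real DIM('a) + 1))"
    using log_step_pos by (intro divide_pos_pos) auto
  then have "0 < ln (depth / 4 / cutoff)" using ln_depth_div_cutoff_ge by linarith
  then show ?thesis using depth_pos cutoff_pos ln_gt_zero_iff[of "depth / 4 / cutoff"] by (simp add: field_simps)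
qed

lemma
  assumes "dist x0 x \<le> depth / 2"
  shows mem_near: "x \<in> \<Omega>" and translate_mem_near: "x + w \<in> \<Omega>"
    and inverse_ell_dB2_near_le: "1 / ell (dB2 \<Omega> x (x + w)) \<le> 2 * log_depth"
proof -
  have depth_le_dB2: "depth \<le> dB2 \<Omega> x0 (x0 + w)" by (simp add: depth_def)
  then have "dist x0 x < dB2 \<Omega> x0 (x0 + w)" using assms depth_pos by linarith
  then show "x \<in> \<Omega>" "x + w \<in> \<Omega>"
    using ball_dB_subset[OF x0_mem(1)] ball_dB_subset[OF x0_mem(2)] by (auto simp: dB2_def subset_eq)
  have "1/2 * depth \<le> dB2 \<Omega> x (x + w)"
    using dB2_translate_ge[of \<Omega> x0 w x] assms depth_le_dB2 by linarith
  then have "1 / ell (dB2 \<Omega> x (x + w)) \<le> 1 / ell (1/2 * depth)"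
    using depth_pos by (intro inverse_ell_antimono) auto
  also have "\<dots> \<le> 2 * log_depth"
    unfolding depth_def log_depth_def using x0_mem by (intro inverse_ell_mult_min_le dB2_pos) auto
  finally show "1 / ell (dB2 \<Omega> x (x + w)) \<le> 2 * log_depth" .
qed

lemma continuous_on_increment_near: "continuous_on (cball x0 (depth / 4)) (increment w u)"
  unfolding increment_def[abs_def] using depth_pos
  by (intro continuous_intros continuous_on_subset[OF u_continuous] continuous_on_compose2[OF u_continuous])
    (auto intro: mem_near translate_mem_near)

lemma nonlocal_op_increment_near_le:
  assumes "dist x0 x \<le> depth / 2"
  shows "nonlocal_op k (increment w u) x \<le> 4 * F * (log_depth\<^sup>2 / log_step)"
proof -
  have "nonlocal_op k (increment w u) x \<le> F * ell (dist (x + w) x) / (ell (dB2 \<Omega> (x + w) x))\<^sup>2"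
    using nonlocal_op_diff_le[of "x + w" x] mem_near[OF assms] translate_mem_near[OF assms] w_nonzero
    by (simp add: nonlocal_op_increment)
  also have "\<dots> = F / log_step * (1 / ell (dB2 \<Omega> x (x + w)))\<^sup>2"
    by (simp add: log_step_def dist_norm dB2_commute[of \<Omega> "x + w"] power_divide)
  also have "\<dots> \<le> F / log_step * (2 * log_depth)\<^sup>2"
    using inverse_ell_dB2_near_le[OF assms] F_nonneg log_step_pos
    by (intro mult_left_mono power_mono) (auto simp: ell_nonneg)
  finally show ?thesis by (simp add: power_mult_distrib mult_ac)
qed

lemma increment_max_principle:
  assumes inc_le: "\<And>x. dist x0 x \<le> depth / 2 \<Longrightarrow> \<bar>increment w u x\<bar> \<le> H"
    and far_le: "\<And>x. dist x0 x \<le> depth / 2 \<Longrightarrow>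
      \<bar>LINT z|lebesgue. increment w u (x + z) * far_kernel (depth / 4) k z\<bar> \<le> S"
    and inc_pos: "0 < increment w u x0"
  shows "lam * (sphere_area DIM('a) * (ln (depth / 4 / cutoff) - 1) * increment w u x0) \<le>
    4 * F * (log_depth\<^sup>2 / log_step) + lam * (M * (sphere_area DIM('a) * (2 / log_step)))
      + Lam * H * sphere_area DIM('a) + S"
proof (rule cone_max_principle[OF borel_measurable_increment[OF u_measurable]
      abs_increment_u_le cutoff_pos cutoff_less])
  have le_half: "dist x0 x \<le> depth / 2" if "x \<in> ball x0 (depth / 4)" for x
    using that depth_pos by simp
  show "(LINT z|lebesgue. increment w u (x + z) * trunc_kernel cutoff (depth / 4) z)
      \<le> M * (sphere_area DIM('a) * (2 / log_step))" for x
  proof -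
    have "(LINT z|lebesgue. increment w u (x + z) * trunc_kernel cutoff (depth / 4) z)
        \<le> M * (sphere_area DIM('a) * norm w / cutoff ^ Suc DIM('a))"
      using abs_integral_increment_trunc_kernel_le[OF cutoff_pos _ _ u_measurable abs_u_le, of "depth / 4" w x]
        depth_pos depth_le norm_w_le_depth by linarith
    also have "\<dots> \<le> M * (sphere_area DIM('a) * (2 / log_step))"
      using mult_left_mono[OF norm_w_div_cutoff_power_le, of "sphere_area DIM('a)"] M_nonneg
      by (intro mult_left_mono) (auto simp: sphere_area_nonneg)
    finally show ?thesis .
  qed
  show "increment w u x \<le> H" if "x \<in> ball x0 (2 * (depth / 4))" for x
    using inc_le[of x] that by auto
  show "(LINT z|lebesgue. increment w u (x + z) * far_kernel (depth / 4) k z) \<le> S"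
    if "x \<in> ball x0 (depth / 4)" for x
    using far_le[OF le_half[OF that]] by linarith
  show "nonlocal_op k (increment w u) x \<le> 4 * F * (log_depth\<^sup>2 / log_step)" if "x \<in> ball x0 (depth / 4)" for x
    using le_half[OF that] by (rule nonlocal_op_increment_near_le)
  show "integrable lebesgue (\<lambda>z. (increment w u x - increment w u (x + z)) * k z)" if "x \<in> ball x0 (depth / 4)" for x
    using mem_near[OF le_half[OF that]] translate_mem_near[OF le_half[OF that]]
    by (rule integrable_nonlocal_increment)
qed (use depth_le inc_pos continuous_on_increment_near in auto)

lemma local_terms_le:
  fixes \<sigma> :: real
  assumes \<sigma>: "0 \<le> \<sigma>"
  shows "4 * F * (log_depth\<^sup>2 / log_step) + lam * (M * (\<sigma> * (2 / log_step)))
    \<le> (4 + 2 * lam * \<sigma>) * (M + F) * (log_depth\<^sup>2 / log_step)"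
proof -
  have "1 / log_step \<le> log_depth\<^sup>2 / log_step"
    using log_depth_ge_1 log_step_pos by (intro divide_right_mono) auto
  then have "4 * F * (log_depth\<^sup>2 / log_step) + 2 * lam * \<sigma> * M * (1 / log_step)
    \<le> 4 * (M + F) * (log_depth\<^sup>2 / log_step) + 2 * lam * \<sigma> * (M + F) * (log_depth\<^sup>2 / log_step)"
    using M_nonneg F_nonneg lam_pos \<sigma> log_step_pos
    by (intro add_mono mult_right_mono mult_mono mult_left_mono) auto
  then show ?thesis by (simp add: algebra_simps)
qed

lemma increment_estimate:
  assumes inc_le: "\<And>x. dist x0 x \<le> depth / 2 \<Longrightarrow> \<bar>increment w u x\<bar> \<le> H"
    and far_le: "\<And>x. dist x0 x \<le> depth / 2 \<Longrightarrow>
      \<bar>LINT z|lebesgue. increment w u (x + z) * far_kernel (depth / 4) k z\<bar> \<le> S"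
  shows "log_step * increment w u x0 \<le> decay_const DIM('a) lam *
    ((4 + 2 * lam * sphere_area DIM('a)) * (M + F) * (log_depth\<^sup>2 / log_step) + Lam * H * sphere_area DIM('a) + S)"
    (is "_ \<le> _ * ?bound")
proof (cases "0 < increment w u x0")
  case False
  have "0 \<le> H" "0 \<le> S" using inc_le[of x0] far_le[of x0] depth_pos by auto
  then have "0 \<le> decay_const DIM('a) lam * ?bound"
    using lam_pos Lam_pos log_step_pos M_nonneg F_nonneg decay_const_nonneg
    by (intro mult_nonneg_nonneg add_nonneg_nonneg) (auto simp: sphere_area_nonneg)
  moreover have "log_step * increment w u x0 \<le> 0"
    using False log_step_pos by (simp add: mult_le_0_iff)
  ultimately show ?thesis by linarith
next
  case True
  let ?\<sigma> = "sphere_area DIM('a)" and ?n = "real DIM('a)"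
  have \<sigma>: "0 < ?\<sigma>" by (rule sphere_area_pos) simp
  have "lam * (?\<sigma> * (log_step / (4 * (?n + 1))) * increment w u x0) \<le>
      lam * (?\<sigma> * (ln (depth / 4 / cutoff) - 1) * increment w u x0)"
    using lam_pos \<sigma> True ln_depth_div_cutoff_ge by (intro mult_left_mono mult_right_mono) auto
  also have "\<dots> \<le> 4 * F * (log_depth\<^sup>2 / log_step) + lam * (M * (?\<sigma> * (2 / log_step))) + Lam * H * ?\<sigma> + S"
    using inc_le far_le True by (rule increment_max_principle)
  also have "\<dots> \<le> ?bound"
    using local_terms_le[OF less_imp_le[OF \<sigma>]] by linarith
  finally have "decay_const DIM('a) lam * (lam * (?\<sigma> * (log_step / (4 * (?n + 1))) * increment w u x0))
      \<le> decay_const DIM('a) lam * ?bound"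
    using decay_const_nonneg by (rule mult_left_mono)
  then show ?thesis
    using lam_pos \<sigma> by (simp add: decay_const_def)
qed

lemma ell_ratio_eq: "ell (norm w) / ell (dB2 \<Omega> x0 (x0 + w)) = log_depth / log_step"
  by (simp add: log_depth_def log_step_def)

lemma far_increment_le_of_bounded:
  "\<bar>LINT z|lebesgue. increment w u (x + z) * far_kernel (depth / 4) k z\<bar>
    \<le> 2 * M * (Lam * (sphere_area DIM('a) * (2 * log_depth)))"
proof -
  have "\<bar>LINT z|lebesgue. increment w u (x + z) * far_kernel (depth / 4) k z\<bar>
      \<le> 2 * M * (Lam * (sphere_area DIM('a) * ln (1 / (depth / 4))))"
    using depth_pos depth_le
    by (intro abs_integral_far_kernel_le borel_measurable_lebesgue_plus borel_measurable_increment
        u_measurable abs_increment_u_le) auto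
  also have "ln (1 / (depth / 4)) = 1 / ell (1/4 * depth)"
    using inverse_ell_mult_min[OF dB2_pos[OF x0_mem], of "1/4"] by (simp add: depth_def)
  also have "\<dots> \<le> 2 * log_depth"
    unfolding depth_def log_depth_def using x0_mem by (intro inverse_ell_mult_min_le dB2_pos) auto
  finally show ?thesis
    using M_nonneg Lam_pos by (simp add: sphere_area_nonneg mult_left_mono)
qed

lemma first_order_terms_le:
  fixes \<sigma> :: real
  assumes \<sigma>: "0 \<le> \<sigma>"
  shows "(4 + 2 * lam * \<sigma>) * (M + F) * (log_depth\<^sup>2 / log_step) + Lam * (2 * M) * \<sigma>
      + 2 * M * (Lam * (\<sigma> * (2 * log_depth)))
    \<le> (4 + 2 * lam * \<sigma> + 6 * Lam * \<sigma>) * (M + F) * log_depth"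
proof -
  have "log_depth / log_step \<le> 1" using log_step_ge_24 log_depth_ge_1 log_step_pos by simp
  then have "log_depth * (log_depth / log_step) \<le> log_depth * 1"
    using log_depth_ge_1 by (intro mult_left_mono) auto
  then have "(4 + 2 * lam * \<sigma>) * (M + F) * (log_depth\<^sup>2 / log_step) \<le> (4 + 2 * lam * \<sigma>) * (M + F) * log_depth"
    using lam_pos M_add_F_nonneg \<sigma> by (intro mult_left_mono) (auto simp: power2_eq_square)
  moreover have "2 * Lam * \<sigma> * M * 1 \<le> 2 * Lam * \<sigma> * (M + F) * log_depth"
    using Lam_pos M_nonneg F_nonneg log_depth_ge_1 \<sigma> by (intro mult_mono) auto
  moreover have "4 * Lam * \<sigma> * M * log_depth \<le> 4 * Lam * \<sigma> * (M + F) * log_depth"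
    using Lam_pos M_nonneg F_nonneg log_depth_ge_1 \<sigma> by (intro mult_right_mono mult_left_mono) auto
  ultimately show ?thesis by (simp add: algebra_simps)
qed

lemma increment_le_first_order:
  "increment w u x0 \<le> decay_const DIM('a) lam * (4 + 2 * lam * sphere_area DIM('a) + 6 * Lam * sphere_area DIM('a))
    * (M + F) * (ell (norm w) / ell (dB2 \<Omega> x0 (x0 + w)))"
proof -
  let ?\<sigma> = "sphere_area DIM('a)"
  have "log_step * increment w u x0 \<le> decay_const DIM('a) lam *
    ((4 + 2 * lam * ?\<sigma>) * (M + F) * (log_depth\<^sup>2 / log_step) + Lam * (2 * M) * ?\<sigma>
      + 2 * M * (Lam * (?\<sigma> * (2 * log_depth))))"
    by (intro increment_estimate abs_increment_u_le far_increment_le_of_bounded)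
  also have "\<dots> \<le> decay_const DIM('a) lam * ((4 + 2 * lam * ?\<sigma> + 6 * Lam * ?\<sigma>) * (M + F) * log_depth)"
    by (intro mult_left_mono first_order_terms_le sphere_area_nonneg decay_const_nonneg)
  finally show ?thesis
    unfolding ell_ratio_eq using log_step_pos by (simp add: field_simps)
qed

end

context log_kernel_equation
begin

lemma abs_diff_le_of_small_increments:
  assumes C: "0 \<le> C"
    and small: "\<And>x w. small_increment k lam Lam \<Omega> u M F x w \<Longrightarrow>
      increment w u x \<le> C * (M + F) * (ell (norm w) / ell (dB2 \<Omega> x (x + w))) ^ p"
    and xy: "x \<in> \<Omega>" "y \<in> \<Omega>" "x \<noteq> y"
  shows "\<bar>u x - u y\<bar> \<le> (C + 2 * (12 * (real DIM('a) + 1)) ^ p) * (M + F) * (ell (dist x y) / ell (dB2 \<Omega> x y)) ^ p"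
proof -
  let ?n = "12 * (real DIM('a) + 1)"
  have one_sided: "increment w u x \<le> (C + 2 * ?n ^ p) * (M + F) * (ell (norm w) / ell (dB2 \<Omega> x (x + w))) ^ p"
    if mem: "x \<in> \<Omega>" "x + w \<in> \<Omega>" "w \<noteq> 0" for x w
  proof (cases "?n * (1 / ell (dB2 \<Omega> x (x + w))) \<le> 1 / ell (norm w)")
    case True
    then have "small_increment k lam Lam \<Omega> u M F x w"
      using mem by unfold_locales
    then have "increment w u x \<le> C * (M + F) * (ell (norm w) / ell (dB2 \<Omega> x (x + w))) ^ p" by (rule small)
    also have "\<dots> \<le> (C + 2 * ?n ^ p) * (M + F) * (ell (norm w) / ell (dB2 \<Omega> x (x + w))) ^ p"
      using M_add_F_nonneg by (intro mult_right_mono) (auto simp: ell_nonneg)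
    finally show ?thesis .
  next
    case False
    define q where "q = ell (norm w) / ell (dB2 \<Omega> x (x + w))"
    have "0 < ell (norm w)" using mem by (intro ell_pos) simp
    then have "1 \<le> ?n * q" using False by (simp add: q_def field_simps)
    then have "1 \<le> (?n * q) ^ p" by (rule one_le_power)
    then have "2 * M * 1 \<le> 2 * (M + F) * (?n * q) ^ p"
      using M_nonneg F_nonneg by (intro mult_mono) auto
    moreover have "increment w u x \<le> 2 * M" using abs_increment_u_le[of w x] by linarith
    moreover have "0 \<le> C * (M + F) * q ^ p" using C M_add_F_nonneg by (simp add: q_def ell_nonneg)
    moreover have "(C + 2 * ?n ^ p) * (M + F) * q ^ p = C * (M + F) * q ^ p + 2 * (M + F) * (?n * q) ^ p"
      unfolding power_mult_distrib by (simp add: algebra_simps)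
    ultimately show ?thesis unfolding q_def[symmetric] by linarith
  qed
  show ?thesis
    using one_sided[of y "x - y"] one_sided[of x "y - x"] xy
    by (simp add: increment_def dist_norm norm_minus_commute dB2_commute abs_le_iff)
qed

lemma abs_diff_le_first_order:
  assumes "x \<in> \<Omega>" "y \<in> \<Omega>" "x \<noteq> y"
  shows "\<bar>u x - u y\<bar> \<le> first_order_const DIM('a) lam Lam * (M + F) * (ell (dist x y) / ell (dB2 \<Omega> x y))"
proof -
  let ?C = "decay_const DIM('a) lam * (4 + 2 * lam * sphere_area DIM('a) + 6 * Lam * sphere_area DIM('a))"
  have "\<bar>u x - u y\<bar> \<le> (?C + 2 * (12 * (real DIM('a) + 1)) ^ 1) * (M + F) * (ell (dist x y) / ell (dB2 \<Omega> x y)) ^ 1"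
  proof (rule abs_diff_le_of_small_increments[OF _ _ assms])
    show "0 \<le> ?C"
      using decay_const_nonneg lam_pos Lam_pos
      by (intro mult_nonneg_nonneg add_nonneg_nonneg) (auto simp: sphere_area_nonneg)
  qed (unfold power_one_right, rule small_increment.increment_le_first_order)
  then show ?thesis by (simp only: power_one_right first_order_const_def)
qed

end

context small_increment
begin

lemma abs_increment_near_le:
  assumes "dist x0 x \<le> depth / 2"
  shows "\<bar>increment w u x\<bar> \<le> first_order_const DIM('a) lam Lam * (M + F) * (2 * log_depth / log_step)"
proof -
  have "\<bar>increment w u x\<bar> \<le> first_order_const DIM('a) lam Lam * (M + F) * (ell (norm w) / ell (dB2 \<Omega> x (x + w)))"
    using abs_diff_le_first_order[of "x + w" x] mem_near[OF assms] translate_mem_near[OF assms] w_nonzero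
    by (simp add: increment_def dist_norm dB2_commute)
  also have "ell (norm w) / ell (dB2 \<Omega> x (x + w)) = 1 / log_step * (1 / ell (dB2 \<Omega> x (x + w)))"
    by (simp add: log_step_def)
  also have "\<dots> \<le> 1 / log_step * (2 * log_depth)"
    using inverse_ell_dB2_near_le[OF assms] log_step_pos by (intro mult_left_mono) auto
  finally show ?thesis
    using first_order_const_pos M_add_F_nonneg by (simp add: mult_left_mono)
qed

lemma far_increment_le_of_regular:
  assumes "dist x0 x \<le> depth / 2"
  shows "\<bar>LINT z|lebesgue. increment w u (x + z) * far_kernel (depth / 4) k z\<bar>
    \<le> M * (Lam * ((2 * log_depth + 16 * 2 ^ DIM('a) * sphere_area DIM('a)) / log_step))"
proof -
  have "4 * norm w \<le> depth / 4" "depth / 4 \<le> 1"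
    using norm_w_le_depth depth_le depth_pos norm_ge_zero[of w] by linarith+
  then have "\<bar>LINT z|lebesgue. increment w u (x + z) * far_kernel (depth / 4) k z\<bar>
    \<le> M * (Lam * (ell (norm w) / ell (depth / 4 / 2) + 2 ^ DIM('a) * sphere_area DIM('a) * (2 * norm w / (depth / 4))))"
    using w_nonzero k_regular[OF mem_near[OF assms] translate_mem_near[OF assms]]
    by (intro abs_integral_increment_far_kernel_le u_measurable abs_u_le)
  also have "\<dots> \<le> M * (Lam * (2 * log_depth / log_step + 2 ^ DIM('a) * sphere_area DIM('a) * (16 / log_step)))"
  proof (intro mult_left_mono add_mono)
    have "ell (norm w) / ell (depth / 4 / 2) = 1 / log_step * (1 / ell (1/8 * depth))" by (simp add: log_step_def)
    also have "\<dots> \<le> 1 / log_step * (2 * log_depth)"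
      unfolding depth_def log_depth_def using x0_mem log_step_pos
      by (intro mult_left_mono inverse_ell_mult_min_le dB2_pos) auto
    finally show "ell (norm w) / ell (depth / 4 / 2) \<le> 2 * log_depth / log_step" by simp
    show "2 * norm w / (depth / 4) \<le> 16 / log_step"
      using mult_left_mono[OF norm_w_div_depth_le, of 8] by (simp add: mult.commute)
  qed (use M_nonneg Lam_pos in \<open>auto simp: sphere_area_nonneg\<close>)
  finally show ?thesis by (simp add: add_divide_distrib mult_ac)
qed

lemma second_order_terms_le:
  fixes c \<sigma> p :: real
  assumes nonneg: "0 \<le> c" "0 \<le> \<sigma>" "0 \<le> p"
  shows "(4 + 2 * lam * \<sigma>) * (M + F) * (log_depth\<^sup>2 / log_step)
      + Lam * (c * (M + F) * (2 * log_depth / log_step)) * \<sigma> + M * (Lam * ((2 * log_depth + p) / log_step))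
    \<le> (4 + 2 * lam * \<sigma> + 2 * c * Lam * \<sigma> + Lam * (2 + p)) * (M + F) * log_depth\<^sup>2 / log_step"
proof -
  have square: "1 \<le> log_depth\<^sup>2" "log_depth \<le> log_depth\<^sup>2"
    using log_depth_ge_1 self_le_power[of log_depth 2] by auto
  have "c * (M + F) * (2 * log_depth) * Lam * \<sigma> \<le> c * (M + F) * (2 * log_depth\<^sup>2) * Lam * \<sigma>"
    using square nonneg M_add_F_nonneg Lam_pos by (intro mult_right_mono mult_left_mono) auto
  moreover have "M * Lam * (2 * log_depth + p * 1) \<le> (M + F) * Lam * (2 * log_depth\<^sup>2 + p * log_depth\<^sup>2)"
    using square log_depth_ge_1 M_nonneg F_nonneg Lam_pos nonneg
    by (intro mult_mono add_mono mult_left_mono mult_right_mono) auto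
  ultimately have "(4 + 2 * lam * \<sigma>) * (M + F) * log_depth\<^sup>2 + c * (M + F) * (2 * log_depth) * Lam * \<sigma>
      + M * Lam * (2 * log_depth + p)
    \<le> (4 + 2 * lam * \<sigma> + 2 * c * Lam * \<sigma> + Lam * (2 + p)) * (M + F) * log_depth\<^sup>2"
    by (simp add: algebra_simps)
  then have "((4 + 2 * lam * \<sigma>) * (M + F) * log_depth\<^sup>2 + c * (M + F) * (2 * log_depth) * Lam * \<sigma>
      + M * Lam * (2 * log_depth + p)) / log_step
    \<le> (4 + 2 * lam * \<sigma> + 2 * c * Lam * \<sigma> + Lam * (2 + p)) * (M + F) * log_depth\<^sup>2 / log_step"
    using log_step_pos by (intro divide_right_mono) auto
  then show ?thesis by (simp add: add_divide_distrib distrib_left mult_ac)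
qed

lemma increment_le_second_order:
  "increment w u x0 \<le> decay_const DIM('a) lam *
      (4 + 2 * lam * sphere_area DIM('a) + 2 * first_order_const DIM('a) lam Lam * Lam * sphere_area DIM('a)
        + Lam * (2 + 16 * 2 ^ DIM('a) * sphere_area DIM('a)))
    * (M + F) * (ell (norm w) / ell (dB2 \<Omega> x0 (x0 + w)))\<^sup>2"
proof -
  let ?\<sigma> = "sphere_area DIM('a)" and ?c = "first_order_const DIM('a) lam Lam"
  let ?p = "16 * 2 ^ DIM('a) * ?\<sigma>"
  have nonneg: "0 \<le> ?c" "0 \<le> ?\<sigma>" "0 \<le> ?p"
    using first_order_const_pos by (simp_all add: sphere_area_nonneg)
  have "log_step * increment w u x0 \<le> decay_const DIM('a) lam *
    ((4 + 2 * lam * ?\<sigma>) * (M + F) * (log_depth\<^sup>2 / log_step)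
      + Lam * (?c * (M + F) * (2 * log_depth / log_step)) * ?\<sigma> + M * (Lam * ((2 * log_depth + ?p) / log_step)))"
    by (intro increment_estimate abs_increment_near_le far_increment_le_of_regular)
  also have "\<dots> \<le> decay_const DIM('a) lam *
      ((4 + 2 * lam * ?\<sigma> + 2 * ?c * Lam * ?\<sigma> + Lam * (2 + ?p)) * (M + F) * log_depth\<^sup>2 / log_step)"
    by (intro mult_left_mono second_order_terms_le nonneg decay_const_nonneg)
  finally have "log_step * increment w u x0 \<le> log_step * (decay_const DIM('a) lam *
      (4 + 2 * lam * ?\<sigma> + 2 * ?c * Lam * ?\<sigma> + Lam * (2 + ?p)) * (M + F) * (log_depth / log_step)\<^sup>2)"
    using log_step_pos by (simp add: power2_eq_square)
  then show ?thesis
    unfolding ell_ratio_eq using log_step_pos by (rule mult_left_le_imp_le)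
qed

end

context log_kernel_equation
begin

lemma abs_diff_le_second_order:
  assumes "x \<in> \<Omega>" "y \<in> \<Omega>" "x \<noteq> y"
  shows "\<bar>u x - u y\<bar> \<le> second_order_const DIM('a) lam Lam * (M + F) * (ell (dist x y) / ell (dB2 \<Omega> x y))\<^sup>2"
  unfolding second_order_const_def
proof (rule abs_diff_le_of_small_increments[OF _ _ assms])
  show "0 \<le> decay_const DIM('a) lam *
      (4 + 2 * lam * sphere_area DIM('a) + 2 * first_order_const DIM('a) lam Lam * Lam * sphere_area DIM('a)
        + Lam * (2 + 16 * 2 ^ DIM('a) * sphere_area DIM('a)))"
    using decay_const_nonneg lam_pos Lam_pos first_order_const_pos
    by (intro mult_nonneg_nonneg add_nonneg_nonneg) (auto simp: sphere_area_nonneg)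
qed (rule small_increment.increment_le_second_order)

end

section \<open>Weighted log-Hoelder norms\<close>

context proper_open
begin

lemma wsemi_le_iff:
  assumes "0 \<le> A"
  shows "wsemi \<beta> \<alpha> \<Omega> u \<le> ennreal A \<longleftrightarrow>
    (\<forall>x\<in>\<Omega>. \<forall>y\<in>\<Omega>. x \<noteq> y \<longrightarrow>
      ell (dB2 \<Omega> x y) powr (\<alpha> + \<beta>) * \<bar>u x - u y\<bar> \<le> A * ell (dist x y) powr \<alpha>)"
proof -
  have "ennreal (ell (dB2 \<Omega> x y) powr (\<alpha> + \<beta>) * \<bar>u x - u y\<bar> / ell (dist x y) powr \<alpha>) \<le> ennreal A \<longleftrightarrow>
      ell (dB2 \<Omega> x y) powr (\<alpha> + \<beta>) * \<bar>u x - u y\<bar> \<le> A * ell (dist x y) powr \<alpha>" if "x \<noteq> y" for x y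
    using that assms ell_pos[of "dist x y"] by (simp add: pos_divide_le_eq)
  then show ?thesis unfolding wsemi_def SUP_le_iff by auto
qed

lemma wsemi_le_of_increments:
  fixes u :: "'a \<Rightarrow> real"
  assumes \<beta>: "0 \<le> \<beta>" "\<beta> \<le> \<gamma>" and bounded: "\<And>x. x \<in> \<Omega> \<Longrightarrow> \<bar>u x\<bar> \<le> m" and A: "0 \<le> A" "2 * m \<le> A"
    and inc: "\<And>x y. x \<in> \<Omega> \<Longrightarrow> y \<in> \<Omega> \<Longrightarrow> x \<noteq> y \<Longrightarrow>
      \<bar>u x - u y\<bar> \<le> A * (ell (dist x y) / ell (dB2 \<Omega> x y)) powr \<gamma>"
  shows "wsemi 0 \<beta> \<Omega> u \<le> ennreal A"
  unfolding wsemi_le_iff[OF A(1)]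
proof (intro ballI impI)
  fix x y assume xy: "x \<in> \<Omega>" "y \<in> \<Omega>" "x \<noteq> y"
  define p q where "p = ell (dB2 \<Omega> x y)" and "q = ell (dist x y)"
  have pos: "0 < p" "0 < q" using xy by (simp_all add: p_def q_def ell_pos dB2_pos)
  have "\<bar>u x - u y\<bar> \<le> A * (q / p) powr \<beta>"
  proof (cases "q / p \<le> 1")
    case True
    then have "A * (q / p) powr \<gamma> \<le> A * (q / p) powr \<beta>"
      using pos \<beta> A by (intro mult_left_mono powr_mono') auto
    then show ?thesis using inc[OF xy] by (simp add: p_def q_def)
  next
    case False
    then have "A * 1 \<le> A * (q / p) powr \<beta>"
      using \<beta> A by (intro mult_left_mono ge_one_powr_ge_zero) auto
    then show ?thesis using bounded[of x] bounded[of y] xy A by linarith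
  qed
  then show "ell (dB2 \<Omega> x y) powr (\<beta> + 0) * \<bar>u x - u y\<bar> \<le> A * ell (dist x y) powr \<beta>"
    using pos by (simp add: p_def[symmetric] q_def[symmetric] powr_divide field_simps)
qed

lemma lsemi_le_of_wsemi:
  assumes \<beta>: "0 \<le> \<beta>" and A: "wsemi 0 \<beta> \<Omega> u \<le> ennreal A" "0 \<le> A"
    and depth: "0 < d" "\<And>x. x \<in> S \<Longrightarrow> d \<le> dB \<Omega> x" and S: "S \<subseteq> \<Omega>"
  shows "lsemi \<beta> S u \<le> ennreal (A / ell d powr \<beta>)"
  unfolding lsemi_def
proof (intro SUP_least ennreal_leI, clarsimp)
  fix x y assume xy: "x \<in> S" "y \<in> S" "x \<noteq> y"
  have "ell d powr \<beta> * \<bar>u x - u y\<bar> \<le> ell (dB2 \<Omega> x y) powr \<beta> * \<bar>u x - u y\<bar>"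
    using depth xy \<beta> by (intro mult_right_mono powr_mono2 ell_mono) (auto simp: dB2_def ell_nonneg)
  also have "\<dots> \<le> A * ell (dist x y) powr \<beta>"
    using A xy S by (auto simp: wsemi_le_iff)
  finally show "\<bar>u x - u y\<bar> / ell (dist x y) powr \<beta> \<le> A / ell d powr \<beta>"
    using ell_pos[of "dist x y"] ell_pos[of d] depth(1) xy by (simp add: field_simps)
qed

lemma Lloc_of_wsemi:
  fixes u :: "'a \<Rightarrow> real"
  assumes \<beta>: "0 \<le> \<beta>" and cont: "continuous_on \<Omega> u" and bounded: "\<And>x. x \<in> \<Omega> \<Longrightarrow> \<bar>u x\<bar> \<le> m"
    and A: "wsemi 0 \<beta> \<Omega> u \<le> ennreal A" "0 \<le> A"
  shows "Lloc \<beta> \<Omega> u"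
  unfolding Lloc_def
proof (intro conjI cont allI impI)
  fix c :: 'a and r :: real
  assume r: "0 < r" and sub: "cball c r \<subseteq> \<Omega>"
  have "continuous_on (cball c r) (dB \<Omega>)"
    unfolding dB_def[abs_def] by (intro continuous_on_infdist continuous_on_id)
  then obtain z where z: "z \<in> cball c r" "\<And>x. x \<in> cball c r \<Longrightarrow> dB \<Omega> z \<le> dB \<Omega> x"
    using continuous_attains_inf[of "cball c r" "dB \<Omega>"] r by auto
  have "lsemi \<beta> (ball c r) u \<le> ennreal (A / ell (dB \<Omega> z) powr \<beta>)"
    using z sub by (intro lsemi_le_of_wsemi[OF \<beta> A] dB_pos) auto
  moreover have "(SUP x\<in>ball c r. ennreal \<bar>u x\<bar>) \<le> ennreal m"
    using sub by (intro SUP_least ennreal_leI bounded) auto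
  ultimately show "(SUP x\<in>ball c r. ennreal \<bar>u x\<bar>) + lsemi \<beta> (ball c r) u < \<infinity>"
    by (auto intro: le_less_trans)
qed

end

section \<open>Interior regularity\<close>

lemma continuous_AE_bound:
  fixes u :: "'a::euclidean_space \<Rightarrow> real"
  assumes "open \<Omega>" "continuous_on \<Omega> u" "AE x \<in> \<Omega> in lebesgue. \<bar>u x\<bar> \<le> m" "x \<in> \<Omega>"
  shows "\<bar>u x\<bar> \<le> m"
proof -
  let ?above = "\<Omega> \<inter> (\<lambda>y. \<bar>u y\<bar>) -` {m<..}"
  have "open ?above"
    using assms(1,2) by (intro continuous_open_preimage continuous_on_rabs) auto
  moreover have "AE y \<in> \<Omega> in lebesgue. y \<in> - ?above"
    using assms(3) by eventually_elim auto
  ultimately have "x \<in> - ?above"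
    by (intro mem_closed_if_AE_lebesgue_open[OF assms(1) _ _ assms(4)] closed_Compl)
  then show ?thesis using assms(4) by auto
qed

lemma Linf_AE_le:
  assumes "Linf S u < \<infinity>"
  shows "AE x in lebesgue_on S. \<bar>u x\<bar> \<le> enn2real (e2ennreal (Linf S u))"
proof -
  have "AE x in lebesgue_on S. ereal \<bar>u x\<bar> \<le> Linf S u"
    unfolding Linf_def by (rule esssup_AE)
  then show ?thesis
  proof eventually_elim
    case (elim x)
    then have "ennreal \<bar>u x\<bar> \<le> e2ennreal (Linf S u)"
      using e2ennreal_mono[OF elim] by simp
    moreover have "e2ennreal (Linf S u) < \<infinity>" using assms by (cases "Linf S u") (auto simp: e2ennreal_neg)
    ultimately show ?case by (metis abs_ge_zero enn2real_ennreal enn2real_mono infinity_ennreal_def)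
  qed
qed

lemma sets_lebesgue_B1: "B1 \<Omega> \<in> sets lebesgue"
  by (intro sets_completionI_sets) (auto simp: B1_def intro!: borel_open)

lemma ball_subset_B1: "x \<in> \<Omega> \<Longrightarrow> ball x 1 \<subseteq> B1 \<Omega>"
  by (auto simp: B1_def)

lemma subset_B1: "\<Omega> \<subseteq> B1 \<Omega>"
  using ball_subset_B1 centre_in_ball by fastforce

definition truncate_on :: "'a set \<Rightarrow> real \<Rightarrow> ('a \<Rightarrow> real) \<Rightarrow> 'a \<Rightarrow> real" where
  "truncate_on S m u x = (if x \<in> S \<and> \<bar>u x\<bar> \<le> m then u x else 0)"

lemma abs_truncate_on_le: "0 \<le> m \<Longrightarrow> \<bar>truncate_on S m u x\<bar> \<le> m"
  by (simp add: truncate_on_def)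

lemma truncate_on_eq: "x \<in> S \<Longrightarrow> \<bar>u x\<bar> \<le> m \<Longrightarrow> truncate_on S m u x = u x"
  by (simp add: truncate_on_def)

lemma borel_measurable_truncate_on:
  fixes u :: "'a::euclidean_space \<Rightarrow> real"
  assumes "S \<in> sets lebesgue" "u \<in> borel_measurable (lebesgue_on S)"
  shows "truncate_on S m u \<in> borel_measurable lebesgue"
proof -
  have [measurable]: "(\<lambda>x. if x \<in> S then u x else 0) \<in> borel_measurable lebesgue"
    using assms(2,1) by (rule borel_measurable_if_I)
  have [measurable]: "Measurable.pred lebesgue (\<lambda>x. x \<in> S)"
    using assms(1) by simp
  have "truncate_on S m u = (\<lambda>x. if x \<in> S \<and> \<bar>if x \<in> S then u x else 0\<bar> \<le> m then if x \<in> S then u x else 0 else 0)"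
    by (auto simp: truncate_on_def fun_eq_iff)
  also have "\<dots> \<in> borel_measurable lebesgue" by measurable
  finally show ?thesis .
qed

definition singular_kernel :: "('a::euclidean_space \<Rightarrow> real) \<Rightarrow> 'a \<Rightarrow> real" where
  "singular_kernel K z = Kext K z / norm z ^ DIM('a)"

lemma borel_measurable_singular_kernel:
  fixes K :: "'a::euclidean_space \<Rightarrow> real"
  assumes "K \<in> borel_measurable (lebesgue_on (ball 0 1))"
  shows "singular_kernel K \<in> borel_measurable lebesgue"
proof -
  have [measurable]: "Kext K \<in> borel_measurable lebesgue"
    unfolding Kext_def[abs_def] using assms by (rule borel_measurable_if_I) simp
  have [measurable]: "(\<lambda>z::'a. norm z ^ DIM('a)) \<in> borel_measurable lebesgue"
    by (rule borel_measurable_lebesgueI) simp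
  show ?thesis unfolding singular_kernel_def[abs_def] by measurable
qed

lemma LK_eq_nonlocal_op:
  fixes K u :: "'a::euclidean_space \<Rightarrow> real"
  assumes K: "K \<in> borel_measurable (lebesgue_on (ball 0 1))"
    and S: "S \<in> sets lebesgue" "ball x 1 \<subseteq> S"
    and u: "u \<in> borel_measurable (lebesgue_on S)" "AE y \<in> S in lebesgue. \<bar>u y\<bar> \<le> m" "\<bar>u x\<bar> \<le> m"
  shows "LK K u x = nonlocal_op (singular_kernel K) (truncate_on S m u) x"
proof -
  let ?k = "singular_kernel K" and ?U = "truncate_on S m u"
  define u0 where "u0 y = (if y \<in> S then u y else 0)" for y
  have [measurable]: "u0 \<in> borel_measurable lebesgue"
    unfolding u0_def[abs_def] using u(1) S(1) by (rule borel_measurable_if_I)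
  have [measurable]: "?U \<in> borel_measurable lebesgue"
    using S(1) u(1) by (rule borel_measurable_truncate_on)
  have [measurable]: "(\<lambda>y. ?k (- x + y)) \<in> borel_measurable lebesgue"
    using borel_measurable_singular_kernel[OF K] by (rule borel_measurable_lebesgue_plus)
  have Ux: "?U x = u x" using S u by (intro truncate_on_eq) auto
  have "LK K u x = (LINT y|lebesgue. (?U x - u0 y) * ?k (- x + y))"
    unfolding LK_def set_lebesgue_integral_def using S(2)
    by (intro Bochner_Integration.integral_cong refl)
      (auto simp: Ux u0_def singular_kernel_def Kext_def dist_norm norm_minus_commute subset_eq split: split_indicator)
  also have "\<dots> = (LINT y|lebesgue. (?U x - ?U y) * ?k (- x + y))"
  proof (rule integral_cong_AE)
    show "AE y in lebesgue. (?U x - u0 y) * ?k (- x + y) = (?U x - ?U y) * ?k (- x + y)"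
      using u(2) by eventually_elim (simp add: u0_def truncate_on_def)
  qed measurable
  also have "\<dots> = (LINT z|lebesgue. (?U x - ?U (x + z)) * ?k (- x + (x + z)))"
    by (rule lebesgue_integral_plus[symmetric]) measurable
  finally show ?thesis by (simp add: nonlocal_op_def)
qed

locale nonlocal_problem = proper_open \<Omega>
  for \<Omega> :: "'a::euclidean_space set" +
  fixes lam Lam :: real and K u :: "'a \<Rightarrow> real"
  assumes lam_pos: "0 < lam"
    and K_measurable: "K \<in> borel_measurable (lebesgue_on (ball 0 1))"
    and K_bounds: "\<And>y. y \<in> ball 0 1 \<Longrightarrow> lam \<le> K y \<and> K y \<le> Lam"
    and K_regular: "regular 1 Lam \<Omega> K"
    and u_measurable: "u \<in> borel_measurable (lebesgue_on (B1 \<Omega>))"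
    and u_bounded: "Linf (B1 \<Omega>) u < \<infinity>"
    and u_Dini: "Dini_loc \<Omega> u"
    and LK_finite: "wnorm 1 1 \<Omega> (LK K u) < \<infinity>"
begin

definition M :: real where
  "M = enn2real (e2ennreal (Linf (B1 \<Omega>) u))"

definition F :: real where
  "F = enn2real (wnorm 1 1 \<Omega> (LK K u))"

lemma M_nonneg: "0 \<le> M" and F_nonneg: "0 \<le> F"
  by (simp_all add: M_def F_def)

lemma ennreal_M: "ennreal M = e2ennreal (Linf (B1 \<Omega>) u)"
  unfolding M_def using u_bounded by (cases "Linf (B1 \<Omega>) u") (auto simp: e2ennreal_neg)

lemma ennreal_F: "ennreal F = wnorm 1 1 \<Omega> (LK K u)"
  unfolding F_def using LK_finite by simp

lemma u_continuous: "continuous_on \<Omega> u"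
  using open_\<Omega> u_Dini by (rule Dini_loc_continuous)

lemma AE_abs_u_le: "AE x \<in> B1 \<Omega> in lebesgue. \<bar>u x\<bar> \<le> M"
  using Linf_AE_le[OF u_bounded] sets_lebesgue_B1[of \<Omega>]
  unfolding M_def by (subst (asm) AE_restrict_space_iff) auto

lemma abs_u_le: "x \<in> \<Omega> \<Longrightarrow> \<bar>u x\<bar> \<le> M"
  using AE_abs_u_le subset_B1[of \<Omega>]
  by (intro continuous_AE_bound[OF open_\<Omega> u_continuous]) (auto elim!: eventually_mono)

lemma truncate_u_eq: "x \<in> \<Omega> \<Longrightarrow> truncate_on (B1 \<Omega>) M u x = u x"
  using subset_B1 abs_u_le by (intro truncate_on_eq) auto

lemma Dini_loc_truncate_u: "Dini_loc \<Omega> (truncate_on (B1 \<Omega>) M u)"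
proof -
  have "(\<forall>x\<in>cball c r. \<forall>y\<in>cball c r. \<bar>truncate_on (B1 \<Omega>) M u x - truncate_on (B1 \<Omega>) M u y\<bar> \<le> \<omega> (dist x y)) \<longleftrightarrow>
      (\<forall>x\<in>cball c r. \<forall>y\<in>cball c r. \<bar>u x - u y\<bar> \<le> \<omega> (dist x y))" if "cball c r \<subseteq> \<Omega>" for c r \<omega>
    using that by (intro ball_cong refl) (simp add: truncate_u_eq subset_eq)
  then show ?thesis using u_Dini by (simp add: Dini_loc_def)
qed

lemma LK_diff_le:
  assumes "x \<in> \<Omega>" "y \<in> \<Omega>" "x \<noteq> y"
  shows "\<bar>LK K u x - LK K u y\<bar> \<le> F * ell (dist x y) / (ell (dB2 \<Omega> x y))\<^sup>2"
proof -
  have pos: "0 < ell (dB2 \<Omega> x y)" "0 < ell (dist x y)"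
    using assms by (simp_all add: ell_pos dB2_pos)
  have "wsemi 1 1 \<Omega> (LK K u) \<le> ennreal F" by (simp add: ennreal_F wnorm_def)
  then have "ell (dB2 \<Omega> x y) powr (1 + 1) * \<bar>LK K u x - LK K u y\<bar> \<le> F * ell (dist x y) powr 1"
    using assms F_nonneg by (auto simp only: wsemi_le_iff)
  then show ?thesis using pos by (simp add: powr_numeral field_simps)
qed

lemma increment_regular_singular_kernel:
  assumes "x \<in> \<Omega>" "x + w \<in> \<Omega>"
  shows "increment_regular (singular_kernel K) Lam w"
proof -
  have "x + w /\<^sub>R 2 + w /\<^sub>R 2 = x + w" by (simp add: add.assoc scaleR_2[symmetric])
  then have "x + w /\<^sub>R 2 + w /\<^sub>R 2 \<in> \<Omega>" "x + w /\<^sub>R 2 - w /\<^sub>R 2 \<in> \<Omega>"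
    using assms by (simp_all only: add_diff_cancel_right')
  then show ?thesis
    using K_regular[unfolded regular_def, rule_format, of "x + w /\<^sub>R 2" w] ell_nonneg[of "norm w"]
    by (simp only: increment_regular_def singular_kernel_def powr_one)
qed

sublocale log_kernel "singular_kernel K" lam Lam
proof
  show "0 < Lam" using K_bounds[of 0] lam_pos by auto
  show "singular_kernel K \<in> borel_measurable lebesgue"
    using K_measurable by (rule borel_measurable_singular_kernel)
  show "lam / norm z ^ DIM('a) \<le> singular_kernel K z" if "norm z < 1" for z
    using that K_bounds[of z] by (auto simp: singular_kernel_def Kext_def intro!: divide_right_mono)
  show "singular_kernel K z \<le> Lam / norm z ^ DIM('a)" if "norm z < 1" for z
    using that K_bounds[of z] by (auto simp: singular_kernel_def Kext_def intro!: divide_right_mono)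
qed (simp_all add: lam_pos singular_kernel_def Kext_def)

sublocale truncated: log_kernel_equation "singular_kernel K" lam Lam \<Omega> "truncate_on (B1 \<Omega>) M u" M F
proof
  show "truncate_on (B1 \<Omega>) M u \<in> borel_measurable lebesgue"
    using sets_lebesgue_B1 u_measurable by (rule borel_measurable_truncate_on)
  have "nonlocal_op (singular_kernel K) (truncate_on (B1 \<Omega>) M u) x = LK K u x" if "x \<in> \<Omega>" for x
    using that
    by (intro LK_eq_nonlocal_op[symmetric] K_measurable sets_lebesgue_B1 ball_subset_B1 u_measurable AE_abs_u_le abs_u_le)
  then show "\<bar>nonlocal_op (singular_kernel K) (truncate_on (B1 \<Omega>) M u) x
      - nonlocal_op (singular_kernel K) (truncate_on (B1 \<Omega>) M u) y\<bar> \<le> F * ell (dist x y) / (ell (dB2 \<Omega> x y))\<^sup>2"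
    if "x \<in> \<Omega>" "y \<in> \<Omega>" "x \<noteq> y" for x y
    using LK_diff_le[OF that] that by simp
qed (use increment_regular_singular_kernel in \<open>auto intro: abs_truncate_on_le M_nonneg F_nonneg Dini_loc_truncate_u\<close>)

lemma abs_u_diff_le:
  assumes "x \<in> \<Omega>" "y \<in> \<Omega>" "x \<noteq> y"
  shows "\<bar>u x - u y\<bar> \<le> second_order_const DIM('a) lam Lam * (M + F) * (ell (dist x y) / ell (dB2 \<Omega> x y))\<^sup>2"
  using truncated.abs_diff_le_second_order[OF assms] assms by (simp add: truncate_u_eq)

theorem interior_log_Hoelder_regularity:
  assumes \<beta>: "0 \<le> \<beta>" "\<beta> \<le> 2"
  shows "Lloc \<beta> \<Omega> u"
    and "wnorm 0 \<beta> \<Omega> u \<le> ennreal (second_order_const DIM('a) lam Lam + 3)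
      * (e2ennreal (Linf (B1 \<Omega>) u) + wnorm 1 1 \<Omega> (LK K u))"
proof -
  let ?c = "second_order_const DIM('a) lam Lam"
  define A where "A = (?c + 2) * (M + F)"
  have A: "0 \<le> A" "2 * M \<le> A" "M + A \<le> (?c + 3) * (M + F)"
    using second_order_const_pos M_nonneg F_nonneg by (simp_all add: A_def algebra_simps)
  have wsemi_le: "wsemi 0 \<beta> \<Omega> u \<le> ennreal A"
  proof (rule wsemi_le_of_increments[OF \<beta> abs_u_le A(1,2)])
    fix x y assume xy: "x \<in> \<Omega>" "y \<in> \<Omega>" "x \<noteq> y"
    let ?q = "ell (dist x y) / ell (dB2 \<Omega> x y)"
    have "\<bar>u x - u y\<bar> \<le> ?c * (M + F) * ?q\<^sup>2" by (rule abs_u_diff_le[OF xy])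
    also have "\<dots> \<le> A * ?q\<^sup>2"
      using M_nonneg F_nonneg by (intro mult_right_mono) (simp_all add: A_def distrib_right)
    finally have "\<bar>u x - u y\<bar> \<le> A * ?q\<^sup>2" .
    moreover have "0 < ?q" using xy by (intro divide_pos_pos ell_pos dB2_pos) auto
    then have "?q\<^sup>2 = ?q powr 2" by (simp only: powr_numeral)
    ultimately show "\<bar>u x - u y\<bar> \<le> A * ?q powr 2" by simp
  qed
  show "Lloc \<beta> \<Omega> u"
    by (rule Lloc_of_wsemi[OF \<beta>(1) u_continuous abs_u_le wsemi_le A(1)])
  have "(SUP x\<in>\<Omega>. ennreal (ell (dB \<Omega> x) powr 0 * \<bar>u x\<bar>)) \<le> ennreal M"
    using abs_u_le by (intro SUP_least ennreal_leI) (auto simp: M_nonneg)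
  then have "wnorm 0 \<beta> \<Omega> u \<le> ennreal (M + A)"
    unfolding wnorm_def using wsemi_le M_nonneg A(1) by (simp add: add_mono)
  also have "\<dots> \<le> ennreal ((?c + 3) * (M + F))" using A(3) by (rule ennreal_leI)
  also have "\<dots> = ennreal (?c + 3) * (e2ennreal (Linf (B1 \<Omega>) u) + wnorm 1 1 \<Omega> (LK K u))"
    using second_order_const_pos M_nonneg F_nonneg by (simp add: ennreal_mult ennreal_M[symmetric] ennreal_F[symmetric])
  finally show "wnorm 0 \<beta> \<Omega> u \<le> ennreal (?c + 3) * (e2ennreal (Linf (B1 \<Omega>) u) + wnorm 1 1 \<Omega> (LK K u))" .
qed

end

theorem theorem4p10:
  fixes lam Lam :: real
  assumes "0 < lam"
  shows "\<exists>\<alpha>::real. 0 < \<alpha> \<and> \<alpha> < 1 \<and>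
    (\<forall>R::real. \<exists>C::real. C > 0 \<and>
      (\<forall>(\<Omega>::'a::euclidean_space set) (K::'a \<Rightarrow> real) (u::'a \<Rightarrow> real).
         open \<Omega> \<and> \<Omega> \<noteq> {} \<and> \<Omega> \<noteq> UNIV
         \<and> bdd_above (dB \<Omega> ` \<Omega>) \<and> (SUP x\<in>\<Omega>. dB \<Omega> x) = R
         \<and> K \<in> borel_measurable (lebesgue_on (ball 0 1))
         \<and> (\<forall>y\<in>ball 0 1. lam \<le> K y \<and> K y \<le> Lam)
         \<and> regular 1 Lam \<Omega> K
         \<and> u \<in> borel_measurable (lebesgue_on (B1 \<Omega>))
         \<and> Linf (B1 \<Omega>) u < \<infinity>
         \<and> Dini_loc \<Omega> u
         \<and> wnorm 1 1 \<Omega> (LK K u) < \<infinity>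
         \<longrightarrow> Lloc (1 + \<alpha>) \<Omega> u
           \<and> wnorm 0 (1 + \<alpha>) \<Omega> u
               \<le> ennreal C * (e2ennreal (Linf (B1 \<Omega>) u) + wnorm 1 1 \<Omega> (LK K u))))"
proof -
  define C where "C = max 1 (second_order_const DIM('a) lam Lam + 3)"
  have C_pos: "0 < C" by (simp add: C_def)
  have estimate: "Lloc (1 + 1/2) \<Omega> u \<and> wnorm 0 (1 + 1/2) \<Omega> u
      \<le> ennreal C * (e2ennreal (Linf (B1 \<Omega>) u) + wnorm 1 1 \<Omega> (LK K u))"
    if "nonlocal_problem \<Omega> lam Lam K u" for \<Omega> :: "'a set" and K u
  proof -
    interpret nonlocal_problem \<Omega> lam Lam K u by (fact that)
    have "wnorm 0 (1 + 1/2) \<Omega> u \<le> ennreal (second_order_const DIM('a) lam Lam + 3)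
        * (e2ennreal (Linf (B1 \<Omega>) u) + wnorm 1 1 \<Omega> (LK K u))"
      by (rule interior_log_Hoelder_regularity) auto
    also have "\<dots> \<le> ennreal C * (e2ennreal (Linf (B1 \<Omega>) u) + wnorm 1 1 \<Omega> (LK K u))"
      by (intro mult_right_mono ennreal_leI) (simp_all add: C_def)
    finally show ?thesis using interior_log_Hoelder_regularity(1)[of "1 + 1/2"] by simp
  qed
  show ?thesis
    by (rule exI[of _ "1/2"], intro C_pos estimate conjI allI exI[of _ C] impI)
      (simp_all add: nonlocal_problem_def nonlocal_problem_axioms_def proper_open_def assms)
qed

end
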